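(* Let $\mathbb F_q$ be a finite field of characteristic two, let $\sigma\in\mathbb F_q$ have absolute trace $1$, and if $q$ is a square let $\theta$ be a non-cube in $\mathbb F_q$. Of all the $q^5(q^2-1)$ distinct cubic rational expressions over $\mathbb F_q$, precisely: (i) $q^2(q^2-1)(q+1)/2$ are equivalent to $x^3$; (ii) $q^2(q^2-1)(q-1)/2$ are equivalent to $\dfrac{x^3+\sigma x+\sigma}{x^2+x+\sigma+1}$; (iii) $q^2(q^2-1)^2$ are equivalent to $x^3+x^2$; (iv) $q^2(q^2-1)^2$ are equivalent to one of $(x^3+1)/x$, $(x^3+\theta)/x$, $(x^3+\theta^2)/x$ (only the first if $q$ is not a square), equally split among these three in case $q$ is a square; (v) for each given $c\in\mathbb F_q\setminus\mathbb F_2$, $q^2(q^2-1)^2/2$ are equivalent to $(x^3+c)/(x+c)$; (vi) for each given $b\in\mathbb F_q\setminus\mathbb F_2$, $q^2(q^2-1)^2/2$ are equivalent to $\dfrac{x^3+bx^2+\sigma x+(b+1)\sigma}{x^2+x+b+1+\sigma}$.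
   Context: A rational expression $R(x)=g(x)/h(x)$ with $g,h$ coprime has degree $\max(\deg g,\deg h)$; cubic means degree $3$. The group $G(\mathbb F_q)=\mathrm{PGL}_2(\mathbb F_q)\times\mathrm{PGL}_2(\mathbb F_q)$, with $\mathrm{PGL}_2(\mathbb F_q)$ identified with the group of degree-one rational expressions (Möbius transformations) over $\mathbb F_q$ under composition, acts on $\mathbb F_q(x)$ by $(B,A)\cdot R(x)=B(R(A^{-1}(x)))$; two expressions are equivalent if they lie in the same $G(\mathbb F_q)$-orbit. The absolute trace of $\sigma$ is $\sigma+\sigma^2+\sigma^4+\cdots+\sigma^{q/2}$. *)

theory Defs
  imports
    "HOL-Computational_Algebra.Computational_Algebra"
    "HOL-Library.Cardinality"
    "HOL-Algebra.Group_Action"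
begin

(* Rational expressions over a field 'a are the elements of the type 'a poly fract, that is,
   of the fraction field of 'a[x]. *)

definition lowest_terms :: "'a::field poly fract \<Rightarrow> 'a poly \<Rightarrow> 'a poly \<Rightarrow> bool" where
  "lowest_terms R g h \<longleftrightarrow> h \<noteq> 0 \<and> coprime g h \<and> R = Fract g h"

definition rat_degree :: "'a::field poly fract \<Rightarrow> nat" where
  "rat_degree R = (THE d. \<exists>g h. lowest_terms R g h \<and> d = max (degree g) (degree h))"

definition rat_eval_poly :: "'a::field poly \<Rightarrow> 'a poly fract \<Rightarrow> 'a poly fract" where
  "rat_eval_poly g S = poly (map_poly (\<lambda>c. to_fract [:c:]) g) S"

(* The composition R(S(x)).  It has the usual meaning whenever the denominator of R does not
   vanish at S, in particular for every nonconstant S. If it vanishes (so S is a constant that is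
   a pole of R), the value is 0, by the convention for division by 0. *)
definition rat_comp :: "'a::field poly fract \<Rightarrow> 'a poly fract \<Rightarrow> 'a poly fract" where
  "rat_comp R S =
     (THE T. \<exists>g h. lowest_terms R g h \<and> T = rat_eval_poly g S / rat_eval_poly h S)"

definition PGL2 :: "'a::field poly fract monoid" where
  "PGL2 = \<lparr>carrier = {A. rat_degree A = 1}, monoid.mult = rat_comp, one = to_fract [:0, 1:]\<rparr>"

(* The action of PGL2 \<times>\<times> PGL2 is only relevant, and only proper, on nonconstant expressions:
   a degree-one B may send a constant to infinity. *)
definition rat_action ::
    "'a::field poly fract \<times> 'a poly fract \<Rightarrow> 'a poly fract \<Rightarrow> 'a poly fract" where
  "rat_action = (\<lambda>(B, A) R. rat_comp B (rat_comp R (inv\<^bsub>PGL2\<^esub> A)))"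

definition rat_equivalent :: "'a::field poly fract \<Rightarrow> 'a poly fract \<Rightarrow> bool" where
  "rat_equivalent R S \<longleftrightarrow> R \<in> orbit (PGL2 \<times>\<times> PGL2) rat_action S"

definition cubics :: "'a::field poly fract set" where
  "cubics = {R. rat_degree R = 3}"

definition cubics_equivalent_to :: "'a::field poly fract \<Rightarrow> 'a poly fract set" where
  "cubics_equivalent_to S = {R \<in> cubics. rat_equivalent R S}"

(* The sum s + s^2 + s^4 + ... + s^(q/2), where q is the number of elements of the field, for q
   a power of 2. *)
definition absolute_trace2 :: "'a::{field, finite} \<Rightarrow> 'a" where
  "absolute_trace2 s = (\<Sum>i | 2 ^ i \<le> CARD('a) div 2. s ^ (2 ^ i))"

lemma lowest_terms_exists: "\<exists>g h. lowest_terms R g h"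
proof -
  define P where "P = (\<lambda>n. \<exists>g h. h \<noteq> 0 \<and> R = Fract g h \<and> degree h = n)"
  have "\<exists>n. P n"
    by (cases R) (auto simp: P_def)
  then have "P (LEAST n. P n)"
    by (rule LeastI_ex)
  then obtain g h where h: "h \<noteq> 0" "R = Fract g h" "degree h = (LEAST n. P n)"
    by (auto simp: P_def)
  have "coprime g h"
  proof (rule coprimeI)
    fix d assume "d dvd g" "d dvd h"
    then obtain g' h' where gh: "g = d * g'" "h = d * h'"
      by (auto elim!: dvdE)
    with h have nz: "d \<noteq> 0" "h' \<noteq> 0" by auto
    with gh h have "R = Fract g' h'"
      by (auto simp: eq_fract)
    with nz have "P (degree h')" by (auto simp: P_def)
    then have "degree h \<le> degree h'"
      using h by (simp add: Least_le)
    with gh nz have "degree d = 0"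
      by (simp add: degree_mult_eq)
    with nz show "is_unit d"
      by (simp add: is_unit_iff_degree)
  qed
  with h show ?thesis
    by (auto simp: lowest_terms_def)
qed

(* The library's facts of this kind need gcd operations on the coefficient field. *)
lemma coprime_poly_dvd_mult:
  fixes g h p :: "'a::field poly"
  assumes dvd: "h dvd p * g" and cop: "coprime h g"
  shows "h dvd p"
proof (cases "h = 0")
  case True
  with cop have "is_unit g" by simp
  with dvd show ?thesis by (simp add: dvd_mult_unit_iff)
next
  case False
  define P where "P = (\<lambda>n. \<exists>a b. a * g + b * h \<noteq> 0 \<and> degree (a * g + b * h) = n)"
  have "P (degree (0 * g + 1 * h))"
    unfolding P_def using False by (intro exI[of _ 0] exI[of _ 1]) simp
  then have "P (LEAST n. P n)" by (rule LeastI)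
  then obtain a b where ab: "a * g + b * h \<noteq> 0" "degree (a * g + b * h) = (LEAST n. P n)"
    by (auto simp: P_def)
  define d where "d = a * g + b * h"
  have d_dvd: "d dvd x * g + y * h" for x y
  proof (rule ccontr)
    assume not_dvd: "\<not> d dvd x * g + y * h"
    define k where "k = (x * g + y * h) div d"
    define r where "r = (x * g + y * h) mod d"
    have "r \<noteq> 0" using not_dvd by (simp add: r_def dvd_eq_mod_eq_0)
    have "r = (x * g + y * h) - k * d"
      by (simp add: r_def k_def minus_div_mult_eq_mod)
    then have "r = (x - k * a) * g + (y - k * b) * h"
      by (simp add: d_def algebra_simps)
    with \<open>r \<noteq> 0\<close> have "P (degree r)" unfolding P_def by metis
    then have "degree d \<le> degree r" using ab by (simp add: d_def Least_le)
    moreover have "degree r < degree d"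
      using \<open>r \<noteq> 0\<close> ab degree_mod_less[of d "x * g + y * h"] by (auto simp: r_def d_def)
    ultimately show False by simp
  qed
  have "d dvd g" "d dvd h" using d_dvd[of 1 0] d_dvd[of 0 1] by simp_all
  with cop have "is_unit d" using coprime_common_divisor by blast
  have "p * d = a * (p * g) + p * b * h" by (simp add: d_def algebra_simps)
  then have "h dvd p * d" using dvd by (metis dvd_add dvd_mult dvd_refl)
  with \<open>is_unit d\<close> show ?thesis by (simp add: dvd_mult_unit_iff)
qed

lemma lowest_terms_unique:
  assumes "lowest_terms R g h" "lowest_terms R g' h'"
  obtains c where "c \<noteq> 0" "g' = smult c g" "h' = smult c h"
proof -
  have nz: "h \<noteq> 0" "h' \<noteq> 0" and cop: "coprime g h" "coprime g' h'"
    and eq: "g * h' = g' * h"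
    using assms by (auto simp: lowest_terms_def eq_fract)
  have "h dvd h' * g" by (metis eq dvd_triv_right mult.commute)
  moreover have "coprime h g" using cop(1) by (simp add: coprime_commute)
  ultimately have 1: "h dvd h'" by (rule coprime_poly_dvd_mult)
  have "h' dvd h * g'" by (metis eq dvd_triv_right mult.commute)
  moreover have "coprime h' g'" using cop(2) by (simp add: coprime_commute)
  ultimately have 2: "h' dvd h" by (rule coprime_poly_dvd_mult)
  obtain u where u: "h' = h * u" using 1 by (elim dvdE)
  have "degree h' = degree h"
    using 1 2 nz by (meson dvd_imp_degree_le le_antisym)
  with u nz have "degree u = 0" "u \<noteq> 0"
    by (auto simp: degree_mult_eq)
  then obtain c where c: "u = [:c:]" "c \<noteq> 0"
    by (metis degree_eq_zeroE pCons_0_0)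
  then have h': "h' = smult c h" using u by simp
  then have "g' * h = smult c g * h" using eq by simp
  then have "g' = smult c g" using nz by (metis mult_right_cancel)
  with h' c that show ?thesis by blast
qed

lemma rat_degree_eq:
  assumes "lowest_terms R g h"
  shows "rat_degree R = max (degree g) (degree h)"
  unfolding rat_degree_def
proof (rule the_equality)
  show "\<exists>g' h'. lowest_terms R g' h' \<and> max (degree g) (degree h) = max (degree g') (degree h')"
    using assms by blast
qed (auto elim!: lowest_terms_unique[OF assms])

lemma rat_eval_poly_smult: "rat_eval_poly (smult c g) S = to_fract [:c:] * rat_eval_poly g S"
proof -
  have "map_poly (\<lambda>c. to_fract [:c:]) (smult c g) =
      smult (to_fract [:c:]) (map_poly (\<lambda>c. to_fract [:c:]) g)"
    by (intro poly_eqI) (simp add: coeff_map_poly to_fract_def mult.commute flip: Zero_fract_def)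
  then show ?thesis by (simp add: rat_eval_poly_def)
qed

lemma rat_comp_eq:
  assumes "lowest_terms R g h"
  shows "rat_comp R S = rat_eval_poly g S / rat_eval_poly h S"
  unfolding rat_comp_def
proof (rule the_equality)
  show "\<exists>g' h'. lowest_terms R g' h' \<and>
      rat_eval_poly g S / rat_eval_poly h S = rat_eval_poly g' S / rat_eval_poly h' S"
    using assms by blast
qed (auto simp: rat_eval_poly_smult elim!: lowest_terms_unique[OF assms])

end

theory Submission
  imports Defs
begin

text \<open>
  Each count is an orbit of a group of order \<open>(q\<^sup>3 - q)\<^sup>2\<close>, so by orbit-stabilizer it is enough to find
  the stabilizers. Since \<open>B \<circ> R = R'\<close> determines \<open>B\<close>, the stabilizer of \<open>g/h\<close> is the set of
  \<open>A\<close> whose substitution maps the plane spanned by the cubic forms \<open>g\<close> and \<open>h\<close> into itself; this is a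
  polynomial condition on the entries of a matrix for \<open>A\<close>, which is solved for each normal form.
  For the forms involving \<open>\<sigma>\<close>, the condition factors once the form is written in the conjugate
  coordinates of the quadratic extension, where \<open>X\<^sup>2 + X + \<sigma>\<close> has a root: \<open>\<sigma>\<close> has trace one
  exactly so that this polynomial has none in the base field.

  The orders of the group and of the set of cubics come from sorting the pairs \<open>(p, r)\<close> of polynomials
  of degree at most \<open>d\<close> by the degree of \<open>p/r\<close>.
\<close>

subsection \<open>Composition of rational expressions\<close>

text \<open>A stabilizing substitution must permute the members of the plane that have a repeated
  linear factor, so it permutes a few marked points of the projective line; this predicts every
  stabilizer that the coordinate computations find. For x^3 the marked points are 0 and infinity,
  and the setwise stabilizer of this pair has order 2(q - 1). In (ii) they are the two conjugate
  roots of X^2 + X + sigma: the expression is cubing in conjugate coordinates, and the order becomes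
  2(q + 1). In (iii), (v) and (vi) the simple roots beside the double ones are marked as well, and
  at most one exchange survives, which gives orders 1, 2 and 2. In (iv) only one member has a
  repeated factor, and scalings by cube roots of unity remain. Stabilizers are counted as sets of
  matrices, so each order appears multiplied by q - 1. Only (iv) compares different orbits: its
  union of three needs their disjointness, which comes from the same computation with two different
  parameters. Cardinalities are cast to reals so that q - 1 and the divisions have their usual
  meaning.\<close>

lemma to_fract_const_add: "to_fract [:a + b:] = to_fract [:a:] + to_fract [:b:]"
  by (metis add.right_neutral add_pCons to_fract_add)

lemma rat_eval_poly_0 [simp]: "rat_eval_poly 0 S = 0"
  by (simp add: rat_eval_poly_def)

lemma rat_eval_poly_pCons [simp]:
  "rat_eval_poly (pCons a p) S = to_fract [:a:] + S * rat_eval_poly p S"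
  by (simp add: rat_eval_poly_def map_poly_pCons)

lemma rat_eval_poly_1 [simp]: "rat_eval_poly 1 S = 1"
  by (simp add: one_pCons flip: to_fract_1)

lemma rat_eval_poly_add: "rat_eval_poly (p + r) S = rat_eval_poly p S + rat_eval_poly r S"
  by (induction p r rule: poly_induct2) (simp_all add: to_fract_const_add algebra_simps)

lemma rat_eval_poly_mult: "rat_eval_poly (p * r) S = rat_eval_poly p S * rat_eval_poly r S"
  by (induction p) (simp_all add: rat_eval_poly_add rat_eval_poly_smult algebra_simps)

lemma rat_eval_poly_X: "rat_eval_poly p (to_fract [:0, 1:]) = to_fract p"
proof (induction p)
  case (pCons a p)
  have "pCons a p = [:a:] + [:0, 1:] * p" by simp
  then have "to_fract (pCons a p) = to_fract [:a:] + to_fract [:0, 1:] * to_fract p"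
    by (simp only: to_fract_add to_fract_mult)
  then show ?case using pCons by simp
qed simp

text \<open>The binary form of degree \<open>n\<close> attached to \<open>g\<close>, evaluated at
  the pair \<open>(p, r)\<close>. The degree is a parameter because the numerator and the
  denominator of an expression must be homogenized in the same degree, which may exceed the degree
  of one of them.\<close>

definition homogenize :: "nat \<Rightarrow> 'a::field poly \<Rightarrow> 'a poly \<Rightarrow> 'a poly \<Rightarrow> 'a poly" where
  "homogenize n g p r = (\<Sum>i\<le>n. smult (coeff g i) (p ^ i * r ^ (n - i)))"

lemma rat_eval_poly_sum:
  assumes "degree g \<le> n"
  shows "rat_eval_poly g S = (\<Sum>i\<le>n. to_fract [:coeff g i:] * S ^ i)"
proof -
  let ?G = "map_poly (\<lambda>c. to_fract [:c:]) g"
  have "degree ?G \<le> n"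
    using map_poly_degree_leq assms le_trans by blast
  then have "(\<Sum>i\<le>degree ?G. coeff ?G i * S ^ i) = (\<Sum>i\<le>n. coeff ?G i * S ^ i)"
    by (intro sum.mono_neutral_left) (auto intro: coeff_eq_0)
  then show ?thesis by (simp add: rat_eval_poly_def poly_altdef coeff_map_poly)
qed

lemma to_fract_power: "to_fract (p ^ n) = to_fract p ^ n"
  by (induction n) simp_all

lemma to_fract_smult: "to_fract (smult c p) = to_fract [:c:] * to_fract p"
  by (simp flip: to_fract_mult)

lemma to_fract_homogenize:
  assumes "degree g \<le> n" "r \<noteq> 0"
  shows "to_fract (homogenize n g p r) = rat_eval_poly g (Fract p r) * to_fract r ^ n"
proof -
  have "to_fract r ^ n = to_fract r ^ i * to_fract r ^ (n - i)" if "i \<le> n" for i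
    using that by (simp flip: power_add)
  moreover have "Fract p r * to_fract r = to_fract p"
    using assms by (simp add: to_fract_def eq_fract)
  then have "Fract p r ^ i * to_fract r ^ i = to_fract p ^ i" for i
    by (metis power_mult_distrib)
  ultimately show ?thesis
    unfolding homogenize_def rat_eval_poly_sum[OF assms(1)] to_fract_sum sum_distrib_right
    by (intro sum.cong refl) (simp add: to_fract_smult to_fract_power ac_simps)
qed

lemma degree_homogenize_le:
  assumes "degree p \<le> m" "degree r \<le> m"
  shows "degree (homogenize n g p r) \<le> n * m"
  unfolding homogenize_def
proof (rule degree_sum_le)
  fix i assume i: "i \<in> {..n}"
  have "degree (p ^ i * r ^ (n - i)) \<le> degree p * i + degree r * (n - i)"
    by (intro order_trans[OF degree_mult_le] add_mono degree_power_le)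
  also have "\<dots> \<le> m * i + m * (n - i)"
    using assms by (intro add_mono mult_right_mono) auto
  also have "\<dots> = n * m" using i by (simp flip: add_mult_distrib2)
  finally show "degree (smult (coeff g i) (p ^ i * r ^ (n - i))) \<le> n * m"
    using degree_smult_le le_trans by blast
qed simp

lemma lowest_terms_Fract:
  assumes "lowest_terms (Fract p r) g h" "r \<noteq> 0"
  obtains u where "u \<noteq> 0" "p = u * g" "r = u * h"
proof -
  have h: "h \<noteq> 0" "coprime h g" and eq: "p * h = g * r"
    using assms by (auto simp: lowest_terms_def eq_fract coprime_commute)
  have "h dvd r * g" by (metis eq dvd_triv_right mult.commute)
  then obtain u where u: "r = h * u"
    using h(2) coprime_poly_dvd_mult by (metis dvdE)
  with eq h have "p = u * g" by (simp add: ac_simps)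
  with u assms that show ?thesis by (auto simp: ac_simps)
qed

lemma rat_degree_Fract_le:
  assumes "r \<noteq> 0"
  shows "rat_degree (Fract p r) \<le> max (degree p) (degree r)"
proof -
  obtain g h where gh: "lowest_terms (Fract p r) g h" using lowest_terms_exists by blast
  obtain u where "u \<noteq> 0" "p = u * g" "r = u * h" using lowest_terms_Fract[OF gh assms] .
  then show ?thesis unfolding rat_degree_eq[OF gh]
    by (cases "g = 0"; cases "h = 0") (auto simp: degree_mult_eq)
qed

text \<open>A nonconstant common factor would push one of the two degrees above the degree of the
  expression. Degree bounds thus certify lowest terms after a substitution, where coprimality is
  hard to see directly.\<close>

lemma lowest_terms_of_degree:
  assumes "r \<noteq> 0" "degree p \<le> rat_degree (Fract p r)" "degree r \<le> rat_degree (Fract p r)"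
  shows "lowest_terms (Fract p r) p r"
proof -
  obtain g h where gh: "lowest_terms (Fract p r) g h" using lowest_terms_exists by blast
  obtain u where u: "u \<noteq> 0" "p = u * g" "r = u * h" using lowest_terms_Fract[OF gh assms(1)] .
  have "h \<noteq> 0" "coprime g h" using gh by (auto simp: lowest_terms_def)
  have "degree u = 0"
    using assms u \<open>h \<noteq> 0\<close> unfolding rat_degree_eq[OF gh]
    by (cases "g = 0") (auto simp: degree_mult_eq max_def split: if_splits)
  then have "is_unit u" using u by (simp add: is_unit_iff_degree)
  then have "coprime p r" using u \<open>coprime g h\<close>
    by (simp add: coprime_mult_left_iff coprime_mult_right_iff is_unit_left_imp_coprime is_unit_right_imp_coprime)
  then show ?thesis using assms by (simp add: lowest_terms_def)
qed

lemma rat_degree_to_fract_const [simp]: "rat_degree (to_fract [:c:]) = 0"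
proof -
  have "lowest_terms (to_fract [:c:]) [:c:] 1" by (simp add: lowest_terms_def to_fract_def)
  then show ?thesis by (simp add: rat_degree_eq)
qed

lemma rat_degree_eq_0_imp_const:
  assumes "rat_degree R = 0"
  obtains c where "R = to_fract [:c:]"
proof -
  obtain g h where gh: "lowest_terms R g h" using lowest_terms_exists by blast
  have "degree g = 0" "degree h = 0" "h \<noteq> 0" "R = Fract g h"
    using assms gh by (auto simp: rat_degree_eq[OF gh] lowest_terms_def)
  then obtain a b where "R = Fract [:a:] [:b:]" "b \<noteq> 0"
    by (metis degree_eq_zeroE pCons_0_0)
  then have "R = to_fract [:a / b:]" by (simp add: to_fract_def eq_fract)
  then show ?thesis using that by blast
qed

(* Clear denominators: for S = p/r in lowest terms a root of h would give r dvd (lead_coeff h) p^n,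
   so r is a unit and S is a polynomial. *)
lemma rat_eval_poly_eq_0_iff:
  assumes "rat_degree S \<noteq> 0"
  shows "rat_eval_poly h S = 0 \<longleftrightarrow> h = 0"
proof
  assume ev: "rat_eval_poly h S = 0"
  show "h = 0"
  proof (rule ccontr)
    assume h: "h \<noteq> 0"
    obtain p r where pr: "lowest_terms S p r" using lowest_terms_exists by blast
    then have r: "r \<noteq> 0" "coprime r p" "S = Fract p r"
      by (auto simp: lowest_terms_def coprime_commute)
    define n where "n = degree h"
    have "to_fract (homogenize n h p r) = 0"
      using to_fract_homogenize[of h n r p] r ev by (simp add: n_def)
    then have "homogenize n h p r = 0" by simp
    then have eq: "smult (lead_coeff h) (p ^ n)
        + (\<Sum>i<n. smult (coeff h i) (p ^ i * r ^ (n - i))) = 0"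
      by (simp add: homogenize_def n_def add.commute flip: lessThan_Suc_atMost)
    have "r dvd (\<Sum>i<n. smult (coeff h i) (p ^ i * r ^ (n - i)))"
      by (intro dvd_sum dvd_smult dvd_mult dvd_power) auto
    then have "r dvd - (\<Sum>i<n. smult (coeff h i) (p ^ i * r ^ (n - i)))" by simp
    then have "r dvd smult (lead_coeff h) (p ^ n)"
      using eq by (simp only: add_eq_0_iff2)
    then have "r dvd 1 * p ^ n" using h by (simp add: dvd_smult_iff)
    moreover have "r dvd 1 * p ^ k \<Longrightarrow> r dvd 1" for k
    proof (induction k)
      case (Suc k)
      then have "r dvd (1 * p ^ k) * p" by (simp add: mult.commute)
      with Suc r(2) show ?case using coprime_poly_dvd_mult by blast
    qed simp
    ultimately have "is_unit r" by blast
    then obtain c where c: "r = [:c:]" "c \<noteq> 0"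
      using r by (metis is_unit_iff_degree degree_eq_zeroE pCons_0_0)
    define s where "s = smult (inverse c) p"
    have S: "S = to_fract s" using c r by (simp add: to_fract_def eq_fract s_def)
    have "degree s = rat_degree S" using c by (simp add: s_def rat_degree_eq[OF pr])
    have "rat_eval_poly t (to_fract s) = to_fract (pcompose t s)" for t
      by (induction t) (simp_all add: pcompose_pCons)
    with ev S have "pcompose h s = 0" by simp
    with h have "degree s = 0" using pcompose_eq_0 by blast
    with assms \<open>degree s = rat_degree S\<close> show False by simp
  qed
qed simp

section \<open>Composition as substitution of a nonconstant expression\<close>

lemma rat_comp_Fract:
  assumes "rat_degree S \<noteq> 0" "r \<noteq> 0"
  shows "rat_comp (Fract p r) S = rat_eval_poly p S / rat_eval_poly r S"
proof -
  obtain g h where gh: "lowest_terms (Fract p r) g h" using lowest_terms_exists by blast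
  obtain u where "u \<noteq> 0" "p = u * g" "r = u * h" using lowest_terms_Fract[OF gh assms(2)] .
  then show ?thesis unfolding rat_comp_eq[OF gh]
    using assms by (simp add: rat_eval_poly_mult rat_eval_poly_eq_0_iff)
qed

lemma rat_comp_to_fract:
  "rat_degree S \<noteq> 0 \<Longrightarrow> rat_comp (to_fract p) S = rat_eval_poly p S"
  by (simp add: to_fract_def rat_comp_Fract)

text \<open>With the product and quotient rules this makes substitution of a fixed nonconstant
  \<open>S\<close> a homomorphism of fields; associativity of composition follows from that.\<close>

lemma rat_comp_add:
  assumes "rat_degree S \<noteq> 0"
  shows "rat_comp (P + R) S = rat_comp P S + rat_comp R S"
proof -
  obtain p r g h where "P = Fract p r" "r \<noteq> 0" "R = Fract g h" "h \<noteq> 0"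
    by (meson Fract_cases)
  then show ?thesis
    using assms
    by (simp add: rat_comp_Fract rat_eval_poly_mult rat_eval_poly_add rat_eval_poly_eq_0_iff
        add_frac_eq)
qed

lemma rat_comp_mult:
  assumes "rat_degree S \<noteq> 0"
  shows "rat_comp (P * R) S = rat_comp P S * rat_comp R S"
proof -
  obtain p r g h where "P = Fract p r" "r \<noteq> 0" "R = Fract g h" "h \<noteq> 0"
    by (meson Fract_cases)
  then show ?thesis
    using assms by (simp add: rat_comp_Fract rat_eval_poly_mult)
qed

lemma rat_comp_divide:
  assumes "rat_degree S \<noteq> 0" "R \<noteq> 0"
  shows "rat_comp (P / R) S = rat_comp P S / rat_comp R S"
proof -
  have "rat_comp P S = rat_comp (P / R) S * rat_comp R S"
    using rat_comp_mult[OF assms(1), of "P / R" R] assms(2) by simp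
  moreover obtain g h where "R = Fract g h" "h \<noteq> 0" "g \<noteq> 0"
    by (metis Fract_cases assms(2) fract_collapse(1))
  then have "rat_comp R S \<noteq> 0"
    using assms by (simp add: rat_comp_Fract rat_eval_poly_eq_0_iff)
  ultimately show ?thesis by simp
qed

lemma rat_comp_X_left: "rat_degree S \<noteq> 0 \<Longrightarrow> rat_comp (to_fract [:0, 1:]) S = S"
  by (simp add: rat_comp_to_fract flip: one_pCons)

lemma rat_comp_X_right: "rat_comp R (to_fract [:0, 1:]) = R"
proof -
  obtain g h where gh: "lowest_terms R g h" using lowest_terms_exists by blast
  then show ?thesis
    unfolding rat_comp_eq[OF gh] rat_eval_poly_X
    by (auto simp: lowest_terms_def to_fract_def)
qed

lemma rat_comp_rat_eval_poly:
  assumes "rat_degree T \<noteq> 0"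
  shows "rat_comp (rat_eval_poly g S) T = rat_eval_poly g (rat_comp S T)"
proof (induction g)
  case 0
  then show ?case using rat_comp_to_fract[OF assms, of 0] by simp
next
  case (pCons a p)
  then show ?case
    using assms by (simp add: rat_comp_add rat_comp_mult rat_comp_to_fract)
qed

text \<open>If R(S) were a constant c and R = g/h, then g - c h would vanish at \<open>S\<close>,
  hence be zero, and R itself would be constant.\<close>

lemma rat_degree_comp_nonzero:
  assumes "rat_degree R \<noteq> 0" "rat_degree S \<noteq> 0"
  shows "rat_degree (rat_comp R S) \<noteq> 0"
proof
  assume "rat_degree (rat_comp R S) = 0"
  then obtain c where c: "rat_comp R S = to_fract [:c:]" by (rule rat_degree_eq_0_imp_const)
  obtain g h where gh: "R = Fract g h" "h \<noteq> 0" by (cases R) auto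
  have "rat_eval_poly g S = to_fract [:c:] * rat_eval_poly h S"
    using c gh assms by (simp add: rat_comp_Fract rat_eval_poly_eq_0_iff field_simps)
  then have "rat_eval_poly (g + smult (- c) h) S = 0"
    unfolding rat_eval_poly_add rat_eval_poly_smult
    using to_fract_const_add[of c "-c"] by (simp flip: distrib_right)
  then have "g + smult (- c) h = 0" using assms rat_eval_poly_eq_0_iff by blast
  then have "R = to_fract [:c:]" using gh by (simp add: to_fract_def eq_fract)
  with assms show False by simp
qed

lemma rat_comp_assoc:
  assumes "rat_degree S \<noteq> 0" "rat_degree T \<noteq> 0"
  shows "rat_comp (rat_comp R S) T = rat_comp R (rat_comp S T)"
proof -
  obtain g h where "R = Fract g h" "h \<noteq> 0" by (cases R) auto
  then show ?thesis
    using assms rat_degree_comp_nonzero[OF assms]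
    by (simp add: rat_comp_Fract rat_comp_divide rat_comp_rat_eval_poly rat_eval_poly_eq_0_iff)
qed

lemma rat_comp_homogenize:
  assumes "rat_degree (Fract p r) \<noteq> 0" "r \<noteq> 0" "h \<noteq> 0" "degree g \<le> n" "degree h \<le> n"
  shows "homogenize n h p r \<noteq> 0"
    and "rat_comp (Fract g h) (Fract p r) = Fract (homogenize n g p r) (homogenize n h p r)"
proof -
  note hom = to_fract_homogenize[OF assms(4,2), of p] to_fract_homogenize[OF assms(5,2), of p]
  have "to_fract (homogenize n h p r) \<noteq> 0"
    using assms by (simp add: hom rat_eval_poly_eq_0_iff)
  then show nz: "homogenize n h p r \<noteq> 0" by auto
  have "Fract (homogenize n g p r) (homogenize n h p r)
      = to_fract (homogenize n g p r) / to_fract (homogenize n h p r)"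
    by (simp add: to_fract_def)
  also have "\<dots> = rat_comp (Fract g h) (Fract p r)"
    using assms by (simp add: hom rat_comp_Fract)
  finally show "rat_comp (Fract g h) (Fract p r)
      = Fract (homogenize n g p r) (homogenize n h p r)" ..
qed

text \<open>For a factor of degree one, this bound applied once more to its inverse turns into an
  equality.\<close>

lemma rat_degree_comp_le:
  assumes "rat_degree S \<noteq> 0"
  shows "rat_degree (rat_comp R S) \<le> rat_degree R * rat_degree S"
proof -
  obtain g h where gh: "lowest_terms R g h" using lowest_terms_exists by blast
  obtain p r where pr: "lowest_terms S p r" using lowest_terms_exists by blast
  let ?n = "rat_degree R" and ?m = "rat_degree S"
  have S: "S = Fract p r" "r \<noteq> 0" "R = Fract g h" "h \<noteq> 0"
    using gh pr by (auto simp: lowest_terms_def)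
  have deg: "degree g \<le> ?n" "degree h \<le> ?n" "degree p \<le> ?m" "degree r \<le> ?m"
    by (simp_all add: rat_degree_eq[OF gh] rat_degree_eq[OF pr])
  note hom = rat_comp_homogenize[OF assms[unfolded S(1)] S(2,4) deg(1,2)]
  have "rat_degree (rat_comp R S) \<le>
      max (degree (homogenize ?n g p r)) (degree (homogenize ?n h p r))"
    using hom rat_degree_Fract_le S by metis
  also have "\<dots> \<le> ?n * ?m"
    using deg by (intro max.boundedI degree_homogenize_le)
  finally show ?thesis .
qed

text \<open>A Bezout combination equal to a nonzero constant serves as the certificate of
  coprimality for all the concrete expressions below.\<close>

lemma lowest_terms_FractI:
  assumes "u * g + v * h = [:k:]" "k \<noteq> 0" "h \<noteq> 0"
  shows "lowest_terms (Fract g h) g h"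
proof -
  have "coprime g h"
  proof (rule coprimeI)
    fix d assume "d dvd g" "d dvd h"
    then have "d dvd [:k:]" by (metis assms(1) dvd_add dvd_mult)
    moreover have "is_unit [:k:]" using assms(2) by (simp add: is_unit_iff_degree)
    ultimately show "is_unit d" by (rule dvd_unit_imp_unit)
  qed
  then show ?thesis using assms by (simp add: lowest_terms_def)
qed

text \<open>A nonconstant \<open>S\<close> satisfies no polynomial relation, so substituting it is
  injective. This is what makes \<open>B\<close> unique in a stabilizing pair
  \<open>(B, A)\<close>.\<close>

lemma rat_comp_right_cancel:
  assumes "rat_degree S \<noteq> 0" "rat_comp P S = rat_comp R S"
  shows "P = R"
proof -
  obtain p r g h where PR: "P = Fract p r" "r \<noteq> 0" "R = Fract g h" "h \<noteq> 0"
    by (meson Fract_cases)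
  then have "rat_eval_poly p S * rat_eval_poly h S = rat_eval_poly g S * rat_eval_poly r S"
    using assms by (simp add: rat_comp_Fract rat_eval_poly_eq_0_iff frac_eq_eq)
  then have "rat_eval_poly (p * h) S = rat_eval_poly (g * r) S"
    by (simp add: rat_eval_poly_mult)
  moreover have "rat_eval_poly (g * r) S = rat_eval_poly (g * r - p * h) S + rat_eval_poly (p * h) S"
    by (simp flip: rat_eval_poly_add)
  ultimately have "g * r - p * h = 0"
    using rat_eval_poly_eq_0_iff[OF assms(1)] by (metis add_cancel_right_left)
  then show ?thesis using PR by (simp add: eq_fract)
qed

subsection \<open>The group of expressions of degree one\<close>

text \<open>The quadruple is the matrix read by rows; coefficient lists start with the constant
  term, hence the reversed order inside the brackets.\<close>

definition mobius :: "'a::field \<times> 'a \<times> 'a \<times> 'a \<Rightarrow> 'a poly fract" where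
  "mobius = (\<lambda>(a, b, c, d). Fract [:b, a:] [:d, c:])"

definition GL2 :: "('a::field \<times> 'a \<times> 'a \<times> 'a) set" where
  "GL2 = {(a, b, c, d). a * d \<noteq> b * c}"

lemma lowest_terms_mobius:
  assumes "a * d \<noteq> b * c"
  shows "lowest_terms (mobius (a, b, c, d)) [:b, a:] [:d, c:]"
proof -
  have "[:c:] * [:b, a:] + [:- a:] * [:d, c:] = [:b * c - a * d:]"
    by (simp add: algebra_simps)
  moreover have "b * c - a * d \<noteq> 0" using assms by simp
  moreover have "[:d, c:] \<noteq> 0" using assms by auto
  ultimately show ?thesis
    unfolding mobius_def split by (rule lowest_terms_FractI)
qed

lemma rat_degree_mobius: "m \<in> GL2 \<Longrightarrow> rat_degree (mobius m) = 1"
  by (auto simp: GL2_def rat_degree_eq[OF lowest_terms_mobius])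

lemma rat_degree_eq_1_imp_mobius:
  assumes "rat_degree A = 1"
  obtains m where "m \<in> GL2" "A = mobius m"
proof -
  obtain p r where pr: "lowest_terms A p r" using lowest_terms_exists by blast
  then have deg: "degree p \<le> 1" "degree r \<le> 1" and r: "r \<noteq> 0" and A: "A = Fract p r"
    using assms by (auto simp: rat_degree_eq lowest_terms_def)
  define a b c d where defs: "a = coeff p 1" "b = coeff p 0" "c = coeff r 1" "d = coeff r 0"
  have lin: "f = [:coeff f 0, coeff f 1:]" if "degree f \<le> 1" for f :: "'a poly"
  proof (rule poly_eqI)
    fix n show "coeff f n = coeff [:coeff f 0, coeff f 1:] n"
      using that by (cases n) (auto simp: coeff_pCons coeff_eq_0 split: nat.split)
  qed
  have p: "p = [:b, a:]" and r': "r = [:d, c:]" using lin deg by (simp_all add: defs)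
  \<comment> \<open>A zero determinant makes numerator and denominator proportional, so that
    \<open>A\<close> would be a constant.\<close>
  have "a * d \<noteq> b * c"
  proof
    assume det: "a * d = b * c"
    obtain k where "A = to_fract [:k:]"
    proof (cases "c = 0")
      case True
      with r r' det have "d \<noteq> 0" "a = 0" by auto
      then have "A = to_fract [:b / d:]"
        using True by (simp add: A p r' to_fract_def eq_fract)
      with that show ?thesis by blast
    next
      case False
      then have "A = to_fract [:a / c:]"
        using det by (simp add: A p r' to_fract_def eq_fract field_simps)
      with that show ?thesis by blast
    qed
    with assms show False by simp
  qed
  then show ?thesis using that[of "(a, b, c, d)"] by (simp add: GL2_def mobius_def A p r')
qed

lemma carrier_PGL2: "carrier PGL2 = {A. rat_degree A = 1}"
  and mult_PGL2: "A \<otimes>\<^bsub>PGL2\<^esub> B = rat_comp A B"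
  and one_PGL2: "\<one>\<^bsub>PGL2\<^esub> = to_fract [:0, 1:]"
  by (simp_all add: PGL2_def)

lemma carrier_PGL2_eq: "carrier PGL2 = mobius ` GL2"
  using rat_degree_mobius rat_degree_eq_1_imp_mobius
  by (fastforce simp: carrier_PGL2)

lemma homogenize_1: "homogenize 1 [:b, a:] p r = smult a p + smult b r"
  by (simp add: homogenize_def add.commute)

lemma rat_comp_mobius_left:
  assumes "(a, b, c, d) \<in> GL2" "rat_degree (Fract g h) \<noteq> 0" "h \<noteq> 0"
  shows "smult c g + smult d h \<noteq> 0"
    and "rat_comp (mobius (a, b, c, d)) (Fract g h)
      = Fract (smult a g + smult b h) (smult c g + smult d h)"
proof -
  have "[:d, c:] \<noteq> 0" "degree [:b, a:] \<le> 1" "degree [:d, c:] \<le> 1"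
    using assms(1) by (auto simp: GL2_def)
  note rat_comp_homogenize[OF assms(2,3) this, unfolded homogenize_1]
  then show "smult c g + smult d h \<noteq> 0"
    and "rat_comp (mobius (a, b, c, d)) (Fract g h)
      = Fract (smult a g + smult b h) (smult c g + smult d h)"
    by (simp_all add: mobius_def)
qed

text \<open>The second matrix is the adjugate of the first, so the product is the determinant times
  the identity.\<close>

lemma mobius_inverse:
  assumes "(a, b, c, d) \<in> GL2"
  shows "rat_comp (mobius (a, b, c, d)) (mobius (d, - b, - c, a)) = to_fract [:0, 1:]"
proof -
  have "(d, - b, - c, a) \<in> GL2" using assms by (simp add: GL2_def mult.commute)
  then have "rat_degree (Fract [:- b, d:] [:a, - c:]) \<noteq> 0"
    using rat_degree_mobius by (fastforce simp: mobius_def)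
  moreover have "[:a, - c:] \<noteq> 0" using assms by (auto simp: GL2_def)
  ultimately have "rat_comp (mobius (a, b, c, d)) (mobius (d, - b, - c, a))
      = Fract [:0, a * d - b * c:] [:a * d - b * c:]"
    using rat_comp_mobius_left(2)[OF assms, of "[:- b, d:]" "[:a, - c:]"]
    by (simp add: mobius_def algebra_simps)
  also have "\<dots> = to_fract [:0, 1:]"
    using assms by (simp add: to_fract_def eq_fract GL2_def)
  finally show ?thesis .
qed

lemma PGL2_inverse_exists:
  assumes "rat_degree A = 1"
  obtains A' where "rat_degree A' = 1" "rat_comp A A' = to_fract [:0, 1:]"
    "rat_comp A' A = to_fract [:0, 1:]"
proof -
  obtain a b c d where m: "(a, b, c, d) \<in> GL2" "A = mobius (a, b, c, d)"
    using assms by (metis rat_degree_eq_1_imp_mobius surj_pair)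
  have m': "(d, - b, - c, a) \<in> GL2" using m by (simp add: GL2_def mult.commute)
  show ?thesis
    using that[OF rat_degree_mobius[OF m']] mobius_inverse[OF m(1)] mobius_inverse[OF m'] m(2)
    by simp
qed

lemma rat_degree_X: "rat_degree (to_fract [:0, 1:]) = 1"
  using rat_degree_mobius[of "(1, 0, 0, 1)"] by (simp add: mobius_def GL2_def to_fract_def one_pCons)

lemma rat_degree_comp_PGL2_right:
  assumes "rat_degree A = 1"
  shows "rat_degree (rat_comp R A) = rat_degree R"
proof -
  obtain A' where A': "rat_degree A' = 1" "rat_comp A A' = to_fract [:0, 1:]"
    using PGL2_inverse_exists[OF assms] by blast
  have "rat_comp (rat_comp R A) A' = R"
    using assms A' by (simp add: rat_comp_assoc rat_comp_X_right)
  then have "rat_degree R \<le> rat_degree (rat_comp R A)"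
    using rat_degree_comp_le[of A' "rat_comp R A"] A' by simp
  moreover have "rat_degree (rat_comp R A) \<le> rat_degree R"
    using rat_degree_comp_le[of A R] assms by simp
  ultimately show ?thesis by simp
qed

lemma rat_degree_comp_PGL2_left:
  assumes "rat_degree B = 1" "rat_degree R \<noteq> 0"
  shows "rat_degree (rat_comp B R) = rat_degree R"
proof -
  obtain B' where B': "rat_degree B' = 1" "rat_comp B' B = to_fract [:0, 1:]"
    using PGL2_inverse_exists[OF assms(1)] by blast
  have nz: "rat_degree (rat_comp B R) \<noteq> 0" using assms by (intro rat_degree_comp_nonzero) auto
  have "rat_comp B' (rat_comp B R) = R"
    using assms B' by (simp add: rat_comp_X_left flip: rat_comp_assoc)
  then have "rat_degree R \<le> rat_degree (rat_comp B R)"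
    using rat_degree_comp_le[of "rat_comp B R" B'] B' nz by simp
  moreover have "rat_degree (rat_comp B R) \<le> rat_degree R"
    using rat_degree_comp_le[of R B] assms by simp
  ultimately show ?thesis by simp
qed

lemma group_PGL2: "group PGL2"
proof (rule groupI)
  fix A :: "'a poly fract" assume "A \<in> carrier PGL2"
  then show "\<exists>B\<in>carrier PGL2. B \<otimes>\<^bsub>PGL2\<^esub> A = \<one>\<^bsub>PGL2\<^esub>"
    unfolding carrier_PGL2 mult_PGL2 one_PGL2 using PGL2_inverse_exists by blast
qed (simp_all add: carrier_PGL2 mult_PGL2 one_PGL2 rat_degree_comp_PGL2_right rat_degree_X
  rat_comp_assoc rat_comp_X_left)

interpretation PGL2: group PGL2
  by (rule group_PGL2)

lemma PGL2_inv:
  assumes "A \<in> carrier PGL2"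
  shows "rat_degree (inv\<^bsub>PGL2\<^esub> A) = 1" "rat_comp A (inv\<^bsub>PGL2\<^esub> A) = to_fract [:0, 1:]"
    "rat_comp (inv\<^bsub>PGL2\<^esub> A) A = to_fract [:0, 1:]"
  using PGL2.inv_closed[OF assms] PGL2.r_inv[OF assms] PGL2.l_inv[OF assms]
  by (simp_all add: carrier_PGL2 mult_PGL2 one_PGL2)

subsection \<open>The action on cubic expressions\<close>

lemma group_PGL2_PGL2: "group (PGL2 \<times>\<times> PGL2)"
  by (intro DirProd_group group_PGL2)

lemma rat_action_cubics:
  assumes "g \<in> carrier (PGL2 \<times>\<times> PGL2)" "R \<in> cubics"
  shows "rat_action g R \<in> cubics"
  using assms
  by (auto simp: rat_action_def cubics_def carrier_PGL2 PGL2_inv(1)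
      rat_degree_comp_PGL2_left rat_degree_comp_PGL2_right)

lemma rat_action_mult:
  assumes "g \<in> carrier (PGL2 \<times>\<times> PGL2)" "h \<in> carrier (PGL2 \<times>\<times> PGL2)" "R \<in> cubics"
  shows "rat_action (g \<otimes>\<^bsub>PGL2 \<times>\<times> PGL2\<^esub> h) R = rat_action g (rat_action h R)"
proof -
  obtain B A B' A' where gh: "g = (B, A)" "h = (B', A')" by (metis surj_pair)
  then have carrier: "A \<in> carrier PGL2" "A' \<in> carrier PGL2" "B \<in> carrier PGL2" "B' \<in> carrier PGL2"
    using assms by auto
  have deg: "rat_degree B = 1" "rat_degree B' = 1" "rat_degree (inv\<^bsub>PGL2\<^esub> A) = 1"
      "rat_degree (inv\<^bsub>PGL2\<^esub> A') = 1" "rat_degree R = 3"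
    using carrier assms by (auto simp: PGL2_inv(1) carrier_PGL2 cubics_def)
  have "inv\<^bsub>PGL2\<^esub> (rat_comp A A') = rat_comp (inv\<^bsub>PGL2\<^esub> A') (inv\<^bsub>PGL2\<^esub> A)"
    using PGL2.inv_mult_group[OF carrier(1,2)] by (simp only: mult_PGL2)
  then show ?thesis
    by (simp add: gh rat_action_def mult_PGL2 rat_comp_assoc deg
        rat_degree_comp_PGL2_left rat_degree_comp_PGL2_right)
qed

lemma rat_action_one: "R \<in> cubics \<Longrightarrow> rat_action \<one>\<^bsub>PGL2 \<times>\<times> PGL2\<^esub> R = R"
  by (simp add: rat_action_def one_PGL2 PGL2.inv_one[unfolded one_PGL2] rat_comp_X_right
      rat_comp_X_left cubics_def)

text \<open>\<open>BijGroup\<close> consists of extensional bijections, so each map of the action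
  has to be restricted to \<open>cubics\<close>.\<close>

lemma group_action_cubics:
  "group_action (PGL2 \<times>\<times> PGL2) cubics (\<lambda>g. restrict (rat_action g) cubics)"
proof -
  let ?G = "PGL2 \<times>\<times> PGL2" and ?\<phi> = "\<lambda>g. restrict (rat_action g) cubics"
  interpret G: group ?G by (rule group_PGL2_PGL2)
  have Bij: "?\<phi> g \<in> Bij cubics" if g: "g \<in> carrier ?G" for g
  proof -
    have g': "inv\<^bsub>?G\<^esub> g \<in> carrier ?G" using g by (rule G.inv_closed)
    have "bij_betw (rat_action g) cubics cubics"
      by (rule bij_betw_byWitness[where f' = "rat_action (inv\<^bsub>?G\<^esub> g)"])
        (use g g' in \<open>auto simp: rat_action_cubics rat_action_one simp del: carrier_DirProd mult_DirProd one_DirProd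
          simp flip: rat_action_mult\<close>)
    then show ?thesis by (simp add: Bij_def)
  qed
  have mult: "?\<phi> (g \<otimes>\<^bsub>?G\<^esub> h) = compose cubics (?\<phi> g) (?\<phi> h)"
    if "g \<in> carrier ?G" "h \<in> carrier ?G" for g h
    using rat_action_mult[OF that] rat_action_cubics[OF that(2)]
    by (auto simp: compose_def restrict_def)
  have "?\<phi> \<in> hom ?G (BijGroup cubics)"
    by (intro homI) (simp_all add: BijGroup_def Bij mult del: carrier_DirProd mult_DirProd)
  then show ?thesis
    by (intro group_action.intro group_hom.intro group_hom_axioms.intro
        group_PGL2_PGL2 group_BijGroup)
qed

text \<open>Composing with \<open>A\<close> on the right removes the inverse from the action. What
  remains compares the planes of forms belonging to \<open>S\<close> and to the substituted
  \<open>R\<close>.\<close>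

lemma cubics_equivalent_to_iff:
  assumes "S \<in> cubics"
  shows "R \<in> cubics_equivalent_to S \<longleftrightarrow>
    (\<exists>A\<in>carrier PGL2. \<exists>B\<in>carrier PGL2. rat_comp B S = rat_comp R A)" (is "?L \<longleftrightarrow> ?R")
proof
  assume ?L
  then obtain B A where BA: "A \<in> carrier PGL2" "B \<in> carrier PGL2"
      "R = rat_comp B (rat_comp S (inv\<^bsub>PGL2\<^esub> A))"
    by (auto simp: cubics_equivalent_to_def rat_equivalent_def orbit_def rat_action_def)
  moreover have deg: "rat_degree A = 1" "rat_degree (inv\<^bsub>PGL2\<^esub> A) = 1" "rat_degree S = 3"
    using BA PGL2_inv(1) assms by (auto simp: carrier_PGL2 cubics_def)
  ultimately have "rat_comp R A = rat_comp B S"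
    by (simp add: rat_comp_assoc rat_degree_comp_PGL2_right PGL2_inv rat_comp_X_right)
  with BA show ?R by (intro bexI[of _ A] bexI[of _ B]) auto
next
  assume ?R
  then obtain A B where BA: "A \<in> carrier PGL2" "B \<in> carrier PGL2" "rat_comp B S = rat_comp R A"
    by blast
  have deg: "rat_degree A = 1" "rat_degree B = 1" "rat_degree (inv\<^bsub>PGL2\<^esub> A) = 1" "rat_degree S = 3"
    using BA PGL2_inv(1) assms by (auto simp: carrier_PGL2 cubics_def)
  have "R = rat_comp (rat_comp R A) (inv\<^bsub>PGL2\<^esub> A)"
    using BA deg by (simp add: rat_comp_assoc rat_degree_X PGL2_inv rat_comp_X_right)
  also have "\<dots> = rat_comp B (rat_comp S (inv\<^bsub>PGL2\<^esub> A))"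
    using deg by (simp add: rat_comp_assoc flip: BA(3))
  finally have "R = rat_action (B, A) S" by (simp add: rat_action_def)
  then show ?L
    using BA assms rat_action_cubics[of "(B, A)" S]
    by (auto simp: cubics_equivalent_to_def rat_equivalent_def orbit_def
        simp del: carrier_DirProd intro!: exI[of _ "(B, A)"]) auto
qed

lemma orbit_cubics:
  assumes "S \<in> cubics"
  shows "orbit (PGL2 \<times>\<times> PGL2) (\<lambda>g. restrict (rat_action g) cubics) S = cubics_equivalent_to S"
  using assms rat_action_cubics[OF _ assms]
  by (auto simp: orbit_def cubics_equivalent_to_def rat_equivalent_def simp del: carrier_DirProd)

lemma mem_cubics_equivalent_to_of_common:
  assumes S: "S \<in> cubics" and T: "T \<in> cubics"
    and R: "R \<in> cubics_equivalent_to S" "R \<in> cubics_equivalent_to T"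
  shows "S \<in> cubics_equivalent_to T"
proof -
  have R': "R \<in> cubics" using R by (simp add: cubics_equivalent_to_def)
  note action = group_action_cubics
  show ?thesis
    using group_action.orbit_sym[OF action S R'] group_action.orbit_trans[OF action T R' S] R
    by (simp add: orbit_cubics S T R')
qed

text \<open>A stabilizing pair is determined by its second component, so projecting to that
  component replaces the stabilizer in the product by a set of elements of a single copy of
  \<open>PGL2\<close>.\<close>

lemma orbit_stabilizer_cubics:
  fixes S :: "'a::field poly fract"
  assumes S: "S \<in> cubics"
  shows "card (cubics_equivalent_to S) *
      card {A \<in> carrier PGL2. \<exists>B\<in>carrier PGL2. rat_comp B S = rat_comp S A}
    = (card (carrier PGL2 :: 'a poly fract set)) ^ 2"
proof -
  let ?G = "PGL2 \<times>\<times> PGL2 :: ('a poly fract \<times> 'a poly fract) monoid"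
  let ?\<phi> = "\<lambda>g. restrict (rat_action g) cubics"
  interpret group_action ?G cubics ?\<phi> by (rule group_action_cubics)
  have deg: "rat_degree S = 3" using S by (simp add: cubics_def)
  have "card (stabilizer ?G ?\<phi> S) =
      card {A \<in> carrier PGL2. \<exists>B\<in>carrier PGL2. rat_comp B S = rat_comp S A}"
  proof (rule bij_betw_same_card)
    have stab: "(B, A) \<in> stabilizer ?G ?\<phi> S \<longleftrightarrow>
        A \<in> carrier PGL2 \<and> B \<in> carrier PGL2 \<and> rat_comp B S = rat_comp S A" for A B
    proof -
      have "rat_comp B (rat_comp S (inv\<^bsub>PGL2\<^esub> A)) = S \<longleftrightarrow> rat_comp B S = rat_comp S A"
        if BA: "A \<in> carrier PGL2" "B \<in> carrier PGL2"
      proof -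
        have degs: "rat_degree A = 1" "rat_degree B = 1" "rat_degree (inv\<^bsub>PGL2\<^esub> A) = 1"
          using BA PGL2_inv(1) by (auto simp: carrier_PGL2)
        have "rat_comp (rat_comp B (rat_comp S (inv\<^bsub>PGL2\<^esub> A))) A = rat_comp B S"
          using BA degs deg
          by (simp add: rat_comp_assoc rat_degree_comp_PGL2_right PGL2_inv rat_comp_X_right)
        then show ?thesis using rat_comp_right_cancel[of A] degs by auto
      qed
      then show ?thesis using S by (auto simp: stabilizer_def rat_action_def)
    qed
    show "bij_betw snd (stabilizer ?G ?\<phi> S)
        {A \<in> carrier PGL2. \<exists>B\<in>carrier PGL2. rat_comp B S = rat_comp S A}"
      unfolding bij_betw_def
    proof
      show "inj_on snd (stabilizer ?G ?\<phi> S)"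
      proof (rule inj_onI)
        fix x y assume "x \<in> stabilizer ?G ?\<phi> S" "y \<in> stabilizer ?G ?\<phi> S" "snd x = snd y"
        moreover obtain B A B' A' where "x = (B, A)" "y = (B', A')" by (metis surj_pair)
        ultimately show "x = y"
          using stab deg rat_comp_right_cancel[of S B B'] by simp
      qed
      show "snd ` stabilizer ?G ?\<phi> S =
          {A \<in> carrier PGL2. \<exists>B\<in>carrier PGL2. rat_comp B S = rat_comp S A}"
      proof (intro equalityI subsetI)
        fix A assume "A \<in> snd ` stabilizer ?G ?\<phi> S"
        then obtain B where "(B, A) \<in> stabilizer ?G ?\<phi> S" by auto
        then show "A \<in> {A \<in> carrier PGL2. \<exists>B\<in>carrier PGL2. rat_comp B S = rat_comp S A}"
          using stab by blast
      next
        fix A assume "A \<in> {A \<in> carrier PGL2. \<exists>B\<in>carrier PGL2. rat_comp B S = rat_comp S A}"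
        then obtain B where "(B, A) \<in> stabilizer ?G ?\<phi> S" using stab by blast
        then show "A \<in> snd ` stabilizer ?G ?\<phi> S" by (metis image_eqI snd_conv)
      qed
    qed
  qed
  moreover have "order ?G = (card (carrier PGL2 :: 'a poly fract set)) ^ 2"
    by (simp add: order_def card_cartesian_product power2_eq_square)
  ultimately show ?thesis using orbit_stabilizer_theorem[OF S]
    by (simp add: orbit_cubics[OF S] del: carrier_DirProd)
qed

text \<open>Composing with \<open>B\<close> on the left only changes the basis of the plane spanned
  by \<open>g\<close> and \<open>h\<close>. Conversely, two forms of that plane define some
  invertible \<open>B\<close> as soon as they are linearly independent, and they are, because their
  quotient still has degree 3.\<close>

lemma ex_PGL2_left_iff:
  assumes R: "Fract g' h' \<in> cubics" "degree g' \<le> 3" "degree h' \<le> 3" "h' \<noteq> 0"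
    and S: "Fract g h \<in> cubics" "degree g \<le> 3" "degree h \<le> 3" "h \<noteq> 0"
    and m: "(a, b, c, d) \<in> GL2"
  shows "(\<exists>B\<in>carrier PGL2. rat_comp B (Fract g h) = rat_comp (Fract g' h') (mobius (a, b, c, d)))
    \<longleftrightarrow> (\<exists>\<alpha> \<beta>. homogenize 3 g' [:b, a:] [:d, c:] = smult \<alpha> g + smult \<beta> h) \<and>
      (\<exists>\<alpha> \<beta>. homogenize 3 h' [:b, a:] [:d, c:] = smult \<alpha> g + smult \<beta> h)"
    (is "?L \<longleftrightarrow> ?R")
proof -
  define P Q where PQ: "P = homogenize 3 g' [:b, a:] [:d, c:]" "Q = homogenize 3 h' [:b, a:] [:d, c:]"
  have dc: "[:d, c:] \<noteq> 0" using m by (auto simp: GL2_def)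
  have deg1: "rat_degree (Fract [:b, a:] [:d, c:]) = 1"
    using rat_degree_mobius[OF m] by (simp add: mobius_def)
  then have "rat_degree (Fract [:b, a:] [:d, c:]) \<noteq> 0" by simp
  note hom = rat_comp_homogenize[OF this dc R(4,2,3), folded PQ]
  have comp: "rat_comp (Fract g' h') (mobius (a, b, c, d)) = Fract P Q"
    using hom by (simp add: mobius_def)
  have degF: "rat_degree (Fract P Q) = 3"
    using rat_degree_comp_PGL2_right[OF deg1, of "Fract g' h'"] R(1) hom(2)
    by (simp add: cubics_def)
  have degPQ: "degree P \<le> 3" "degree Q \<le> 3"
    unfolding PQ by (rule order_trans[OF degree_homogenize_le[of _ 1]]; simp)+
  \<comment> \<open>Both sides of the equation for \<open>B\<close> are put in lowest terms by their
    degrees, so they can differ only by a common scalar.\<close>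
  have PQ_lowest: "lowest_terms (Fract P Q) P Q"
    using hom(1) degPQ degF by (intro lowest_terms_of_degree) auto
  have degS: "rat_degree (Fract g h) \<noteq> 0" using S by (simp add: cubics_def)
  \<comment> \<open>Linear independence of the transformed pair: a proportional pair would have a
    constant quotient.\<close>
  have no_relation: "x = 0 \<and> y = 0" if eq: "smult x P = smult y Q" for x y
  proof (cases "x = 0")
    case True
    then show ?thesis using eq hom(1) by simp
  next
    case False
    then have "Fract P Q = to_fract [:y / x:]"
      using eq hom(1) by (simp add: to_fract_def eq_fract)
        (metis divide_inverse_commute smult_smult left_inverse smult_1_left)
    with degF show ?thesis by simp
  qed
  show ?thesis
  proof
    assume ?L
    then obtain m' where m': "m' \<in> GL2" "rat_comp (mobius m') (Fract g h) = Fract P Q"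
      unfolding comp carrier_PGL2_eq by auto
    obtain \<alpha> \<beta> \<gamma> \<delta> where "m' = (\<alpha>, \<beta>, \<gamma>, \<delta>)" by (metis surj_pair)
    note m' = m'[unfolded this]
    let ?P = "smult \<alpha> g + smult \<beta> h" and ?Q = "smult \<gamma> g + smult \<delta> h"
    have eq: "Fract P Q = Fract ?P ?Q"
      using rat_comp_mobius_left(2)[OF m'(1) degS S(4)] m'(2) by simp
    have nz: "?Q \<noteq> 0" using rat_comp_mobius_left(1)[OF m'(1) degS S(4)] .
    have "degree ?P \<le> 3" "degree ?Q \<le> 3"
      using S degree_smult_le le_trans by (blast intro: degree_add_le)+
    then have "lowest_terms (Fract P Q) ?P ?Q"
      using lowest_terms_of_degree[OF nz] degF by (simp add: eq)
    then obtain k where "P = smult k ?P" "Q = smult k ?Q"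
      using lowest_terms_unique[OF _ PQ_lowest] by metis
    then have "P = smult (k * \<alpha>) g + smult (k * \<beta>) h" "Q = smult (k * \<gamma>) g + smult (k * \<delta>) h"
      by (simp_all add: smult_add_right)
    then show ?R unfolding PQ by blast
  next
    assume ?R
    then obtain \<alpha> \<beta> \<gamma> \<delta> where span: "P = smult \<alpha> g + smult \<beta> h" "Q = smult \<gamma> g + smult \<delta> h"
      unfolding PQ by blast
    have "\<alpha> * \<delta> \<noteq> \<beta> * \<gamma>"
    proof
      assume "\<alpha> * \<delta> = \<beta> * \<gamma>"
      then have "smult \<gamma> P = smult \<alpha> Q" "smult \<delta> P = smult \<beta> Q"
        unfolding span by (simp_all add: smult_add_right mult.commute)
      then have "\<gamma> = 0" "\<delta> = 0" using no_relation by blast+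
      then show False using hom(1) span by simp
    qed
    then have m': "(\<alpha>, \<beta>, \<gamma>, \<delta>) \<in> GL2" by (simp add: GL2_def)
    then have "rat_comp (mobius (\<alpha>, \<beta>, \<gamma>, \<delta>)) (Fract g h) = Fract P Q"
      using rat_comp_mobius_left(2)[OF m' degS S(4)] span by simp
    then show ?L unfolding comp carrier_PGL2_eq using m' by blast
  qed
qed

subsection \<open>Counting expressions of a given degree\<close>

lemma card_degree_le:
  shows "finite {p :: 'a::{field, finite} poly. degree p \<le> n}"
    and "card {p :: 'a poly. degree p \<le> n} = CARD('a) ^ (n + 1)"
proof -
  let ?P = "\<lambda>n. {p :: 'a poly. degree p \<le> n}"
  have P_0: "?P 0 = (\<lambda>a. [:a:]) ` UNIV" by (auto elim: degree_eq_zeroE)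
  have P_Suc: "?P (Suc n) = (\<lambda>(a, p). pCons a p) ` (UNIV \<times> ?P n)" for n
  proof (intro equalityI subsetI)
    fix p assume "p \<in> ?P (Suc n)"
    moreover obtain a p' where "p = pCons a p'" by (rule pCons_cases)
    ultimately show "p \<in> (\<lambda>(a, p). pCons a p) ` (UNIV \<times> ?P n)"
      by (auto split: if_splits)
  qed (auto intro: order_trans[OF degree_pCons_le])
  have "finite (?P n) \<and> card (?P n) = CARD('a) ^ (n + 1)"
  proof (induction n)
    case 0
    show ?case unfolding P_0 by (simp add: card_image inj_on_def)
  next
    case (Suc n)
    have "inj_on (\<lambda>(a, p). pCons a p) (UNIV \<times> ?P n)" by (auto simp: inj_on_def)
    then show ?case
      using Suc unfolding P_Suc by (simp add: card_image card_cartesian_product)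
  qed
  then show "finite (?P n)" "card (?P n) = CARD('a) ^ (n + 1)" by auto
qed

text \<open>Every such pair is a common multiple \<open>(u * g, u * h)\<close> of the reduced one,
  and its degree bound says exactly that \<open>u\<close> has degree at most
  \<open>d - rat_degree R\<close>. The subtracted 1 is the excluded \<open>u = 0\<close>.\<close>

lemma card_fractions_eq:
  fixes R :: "'a::{field, finite} poly fract"
  assumes "rat_degree R \<le> d"
  shows "card {(p, r). r \<noteq> 0 \<and> degree p \<le> d \<and> degree r \<le> d \<and> Fract p r = R}
    = CARD('a) ^ (d - rat_degree R + 1) - 1"
proof -
  obtain g h where gh: "lowest_terms R g h" using lowest_terms_exists by blast
  then have h: "h \<noteq> 0" and R: "R = Fract g h" by (auto simp: lowest_terms_def)
  let ?U = "{u. degree u \<le> d - rat_degree R}"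
  have "{(p, r). r \<noteq> 0 \<and> degree p \<le> d \<and> degree r \<le> d \<and> Fract p r = R}
      = (\<lambda>u. (u * g, u * h)) ` (?U - {0})" (is "?L = ?R")
  proof (intro equalityI subsetI)
    fix x assume "x \<in> ?L"
    then obtain p r where x: "x = (p, r)" and r: "r \<noteq> 0" and deg: "degree p \<le> d" "degree r \<le> d"
      and eq: "Fract p r = R" by auto
    obtain u where u: "u \<noteq> 0" "p = u * g" "r = u * h"
      using lowest_terms_Fract[OF gh[folded eq] r] .
    have "degree u + degree g \<le> d \<or> g = 0" "degree u + degree h \<le> d"
      using deg u h by (auto simp: degree_mult_eq)
    then have "degree u + rat_degree R \<le> d" by (auto simp: rat_degree_eq[OF gh])
    with u x show "x \<in> ?R" by auto
  next
    fix x assume "x \<in> ?R"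
    then obtain u where u: "u \<noteq> 0" "degree u \<le> d - rat_degree R" "x = (u * g, u * h)" by auto
    have "degree (u * g) \<le> d" "degree (u * h) \<le> d"
      using u assms degree_mult_le[of u g] degree_mult_le[of u h]
      by (auto simp: rat_degree_eq[OF gh])
    with u h show "x \<in> ?L" by (auto simp: R eq_fract)
  qed
  moreover have "inj_on (\<lambda>u. (u * g, u * h)) (?U - {0})" using h by (auto simp: inj_on_def)
  ultimately show ?thesis by (simp add: card_image card_degree_le)
qed

lemma finite_rat_degree_le: "finite {R :: 'a::{field, finite} poly fract. rat_degree R \<le> d}"
proof (rule finite_subset)
  let ?P = "{p :: 'a poly. degree p \<le> d}"
  show "{R. rat_degree R \<le> d} \<subseteq> (\<lambda>(p, r). Fract p r) ` (?P \<times> ?P)"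
  proof
    fix R :: "'a poly fract" assume R: "R \<in> {R. rat_degree R \<le> d}"
    obtain g h where gh: "lowest_terms R g h" using lowest_terms_exists by blast
    then have "R = Fract g h" by (simp add: lowest_terms_def)
    moreover have "(g, h) \<in> ?P \<times> ?P" using R by (simp add: rat_degree_eq[OF gh])
    ultimately show "R \<in> (\<lambda>(p, r). Fract p r) ` (?P \<times> ?P)" by (metis case_prod_conv image_eqI)
  qed
qed (simp add: card_degree_le)

(* Both sides count the pairs (p, r) with r nonzero and both degrees at most d; the right-hand side
   sorts them by the degree j of p/r, the common factor having degree at most d - j. *)
lemma sum_card_rat_degree:
  fixes d :: nat
  defines "q \<equiv> real CARD('a::{field, finite})"
  shows "q ^ (d + 1) * (q ^ (d + 1) - 1)
    = (\<Sum>j\<le>d. real (card {R :: 'a poly fract. rat_degree R = j}) * (q ^ (d - j + 1) - 1))"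
proof -
  let ?P = "{p :: 'a poly. degree p \<le> d}" and ?D = "{R :: 'a poly fract. rat_degree R \<le> d}"
  let ?T = "?P \<times> (?P - {0})"
  have finP: "finite ?P" by (rule card_degree_le)
  have q: "1 \<le> CARD('a) ^ k" for k by (simp add: Suc_leI)
  have "(\<Sum>R\<in>?D. \<Sum>x\<in>{x \<in> ?T. (\<lambda>(p, r). Fract p r) x = R}. 1) = (\<Sum>x\<in>?T. 1 :: real)"
  proof (rule sum.group)
    show "(\<lambda>(p, r). Fract p r) ` ?T \<subseteq> ?D"
      by (auto intro: order_trans[OF rat_degree_Fract_le])
  qed (use finP finite_rat_degree_le in auto)
  also have "\<dots> = real (card ?T)" by simp
  also have "\<dots> = q ^ (d + 1) * (q ^ (d + 1) - 1)"
    using q[of "d + 1"] finP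
    by (simp add: card_cartesian_product card_degree_le q_def of_nat_diff del: power_Suc)
  also have "(\<Sum>R\<in>?D. \<Sum>x\<in>{x \<in> ?T. (\<lambda>(p, r). Fract p r) x = R}. 1)
      = (\<Sum>R\<in>?D. q ^ (d - rat_degree R + 1) - 1)"
  proof (rule sum.cong[OF refl])
    fix R :: "'a poly fract" assume "R \<in> ?D"
    then have deg: "rat_degree R \<le> d" by simp
    have "{x \<in> ?T. (\<lambda>(p, r). Fract p r) x = R}
        = {(p, r). r \<noteq> 0 \<and> degree p \<le> d \<and> degree r \<le> d \<and> Fract p r = R}" by auto
    then show "(\<Sum>x\<in>{x \<in> ?T. (\<lambda>(p, r). Fract p r) x = R}. 1) = q ^ (d - rat_degree R + 1) - 1"
      using card_fractions_eq[OF deg] q[of "d - rat_degree R + 1"]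
      by (simp add: q_def of_nat_diff del: power_Suc)
  qed
  also have "\<dots> = (\<Sum>j\<in>{..d}. \<Sum>R\<in>{R \<in> ?D. rat_degree R = j}. q ^ (d - rat_degree R + 1) - 1)"
    by (rule sum.group[symmetric]) (use finite_rat_degree_le in auto)
  also have "\<dots> = (\<Sum>j\<le>d. real (card {R :: 'a poly fract. rat_degree R = j}) * (q ^ (d - j + 1) - 1))"
  proof (rule sum.cong[OF refl])
    fix j assume "j \<in> {..d}"
    then have "{R \<in> ?D. rat_degree R = j} = {R. rat_degree R = j}" by auto
    then show "(\<Sum>R\<in>{R \<in> ?D. rat_degree R = j}. q ^ (d - rat_degree R + 1) - 1)
        = real (card {R :: 'a poly fract. rat_degree R = j}) * (q ^ (d - j + 1) - 1)" by simp
  qed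
  finally show ?thesis ..
qed

lemma card_field_ge_2: "CARD('a::{field, finite}) \<ge> 2"
proof -
  have "card {0, 1 :: 'a} \<le> CARD('a)" by (rule card_mono) auto
  then show ?thesis by simp
qed

text \<open>The identities for d = 0, 1, 2, 3 form a triangular system: in the one for d, the
  unknown \<open>D d\<close> has coefficient q - 1, and all others were found before.\<close>

lemma
  defines "q \<equiv> real CARD('a::{field, finite})"
  shows card_PGL2: "real (card (carrier PGL2 :: 'a poly fract set)) = q ^ 3 - q"
    and card_cubics: "real (card (cubics :: 'a poly fract set)) = q ^ 5 * (q ^ 2 - 1)"
proof -
  define D where "D j = real (card {R :: 'a poly fract. rat_degree R = j})" for j
  have "q \<ge> 2" using card_field_ge_2[where 'a='a] by (simp add: q_def)
  then have q: "q - 1 \<noteq> 0" by simp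
  have E: "q ^ (d + 1) * (q ^ (d + 1) - 1) = (\<Sum>j\<le>d. D j * (q ^ (d - j + 1) - 1))" for d
    using sum_card_rat_degree[where 'a='a, of d] by (simp only: D_def q_def)
  have "(D 0 - q) * (q - 1) = 0" using E[of 0] by (simp add: algebra_simps)
  then have D0: "D 0 = q" using q by simp
  have "(D 1 - (q ^ 3 - q)) * (q - 1) = 0"
    using E[of 1] by (simp add: D0 algebra_simps eval_nat_numeral)
  then have D1: "D 1 = q ^ 3 - q" using q by simp
  have "(D 2 - q ^ 3 * (q ^ 2 - 1)) * (q - 1) = 0"
    using E[of 2] by (simp add: D0 D1[simplified] algebra_simps eval_nat_numeral)
  then have D2: "D 2 = q ^ 3 * (q ^ 2 - 1)" using q by simp
  have "(D 3 - q ^ 5 * (q ^ 2 - 1)) * (q - 1) = 0"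
    using E[of 3] by (simp add: D0 D1[simplified] D2[simplified numeral_2_eq_2] algebra_simps eval_nat_numeral)
  then have D3: "D 3 = q ^ 5 * (q ^ 2 - 1)" using q by simp
  show "real (card (carrier PGL2 :: 'a poly fract set)) = q ^ 3 - q"
    using D1 by (simp add: D_def carrier_PGL2)
  show "real (card (cubics :: 'a poly fract set)) = q ^ 5 * (q ^ 2 - 1)"
    using D3 by (simp add: D_def cubics_def)
qed

section \<open>Matrices in place of expressions of degree one\<close>

lemma mobius_eq_iff:
  assumes "(a, b, c, d) \<in> GL2" "m \<in> GL2"
  shows "mobius m = mobius (a, b, c, d) \<longleftrightarrow> (\<exists>k. k \<noteq> 0 \<and> m = (k * a, k * b, k * c, k * d))"
proof
  assume eq: "mobius m = mobius (a, b, c, d)"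
  obtain a' b' c' d' where m: "m = (a', b', c', d')" by (metis surj_pair)
  have "lowest_terms (mobius (a, b, c, d)) [:b, a:] [:d, c:]"
    "lowest_terms (mobius (a, b, c, d)) [:b', a':] [:d', c':]"
    using assms lowest_terms_mobius[of a d b c] lowest_terms_mobius[of a' d' b' c']
    by (auto simp: GL2_def m eq[unfolded m, symmetric])
  then obtain k where "k \<noteq> 0" "[:b', a':] = smult k [:b, a:]" "[:d', c':] = smult k [:d, c:]"
    by (rule lowest_terms_unique)
  then show "\<exists>k. k \<noteq> 0 \<and> m = (k * a, k * b, k * c, k * d)" by (auto simp: m)
next
  assume "\<exists>k. k \<noteq> 0 \<and> m = (k * a, k * b, k * c, k * d)"
  then obtain k where k: "k \<noteq> 0" "m = (k * a, k * b, k * c, k * d)" by auto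
  have "[:d, c:] \<noteq> 0" "[:k * d, k * c:] \<noteq> 0" using assms k by (auto simp: GL2_def)
  then show "mobius m = mobius (a, b, c, d)"
    unfolding k mobius_def split by (subst eq_fract(1)) (auto simp: algebra_simps)
qed

text \<open>Each fibre of \<open>mobius\<close> consists of the nonzero scalar multiples of one
  matrix. A stabilizer can therefore be counted without normalizing representatives.\<close>

lemma card_GL2_mobius:
  "card {m \<in> GL2. P (mobius m)} = (CARD('a) - 1) * card {A \<in> carrier PGL2. P A}"
  for P :: "'a::{field, finite} poly fract \<Rightarrow> bool"
proof -
  let ?M = "{m \<in> GL2. P (mobius m)}" and ?C = "{A \<in> carrier PGL2. P A}"
  have finC: "finite ?C"
    by (rule finite_subset[OF _ finite_rat_degree_le[of 1]]) (auto simp: carrier_PGL2)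
  have "(\<Sum>A\<in>?C. \<Sum>m\<in>{m \<in> ?M. mobius m = A}. 1) = (\<Sum>m\<in>?M. 1 :: nat)"
    by (rule sum.group) (use finC in \<open>auto simp: carrier_PGL2_eq\<close>)
  moreover have "card {m \<in> ?M. mobius m = A} = CARD('a) - 1" if A: "A \<in> ?C" for A
  proof -
    obtain a b c d where m: "(a, b, c, d) \<in> GL2" "A = mobius (a, b, c, d)"
      using A by (auto simp: carrier_PGL2_eq)
    have scaled: "(k * a, k * b, k * c, k * d) \<in> GL2" if "k \<noteq> 0" for k
      using m that by (simp add: GL2_def)
    have "{m \<in> ?M. mobius m = A} = (\<lambda>k. (k * a, k * b, k * c, k * d)) ` (UNIV - {0})"
    proof (intro equalityI subsetI)
      fix x assume "x \<in> {m \<in> ?M. mobius m = A}"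
      then obtain k where "k \<noteq> 0" "x = (k * a, k * b, k * c, k * d)"
        using mobius_eq_iff[OF m(1), of x] m(2) by auto
      then show "x \<in> (\<lambda>k. (k * a, k * b, k * c, k * d)) ` (UNIV - {0})" by blast
    next
      fix x assume "x \<in> (\<lambda>k. (k * a, k * b, k * c, k * d)) ` (UNIV - {0})"
      then obtain k where k: "k \<noteq> 0" "x = (k * a, k * b, k * c, k * d)" by blast
      then have "mobius x = A" using mobius_eq_iff[OF m(1)] scaled m(2) by blast
      then show "x \<in> {m \<in> ?M. mobius m = A}" using A scaled k by simp
    qed
    moreover have "inj_on (\<lambda>k. (k * a, k * b, k * c, k * d)) (UNIV - {0})"
      using m by (auto simp: inj_on_def GL2_def)
    ultimately show ?thesis by (simp add: card_image card_Diff_singleton)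
  qed
  ultimately show ?thesis by (simp add: mult.commute)
qed

subsection \<open>Finite fields of characteristic two\<close>

text \<open>Multiplication by a nonzero \<open>x\<close> permutes the nonzero elements; comparing
  their products gives x^(q - 1) = 1.\<close>

lemma finite_field_power_card: "x ^ CARD('a) = x" for x :: "'a::{field, finite}"
proof (cases "x = 0")
  case True
  then show ?thesis by (simp add: power_0_left)
next
  case False
  let ?U = "UNIV - {0 :: 'a}"
  have "bij_betw ((*) x) ?U ?U"
    by (rule bij_betw_byWitness[where f' = "\<lambda>y. y / x"]) (use False in auto)
  then have "(\<Prod>y\<in>?U. x * y) = \<Prod>?U" by (rule prod.reindex_bij_betw)
  then have "x ^ card ?U * \<Prod>?U = \<Prod>?U" by (simp add: prod.distrib)
  then have "x ^ (CARD('a) - 1) = 1" by simp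
  then have "x ^ Suc (CARD('a) - 1) = x" by (simp only: power_Suc mult_1_right)
  then show ?thesis by simp
qed

context
  assumes char2: "CHAR('a::{field, finite}) = 2"
begin

lemma two_eq_0: "(2 :: 'a) = 0"
  using of_nat_CHAR[where 'a='a] by (simp add: char2)

lemma add_self: "(x :: 'a) + x = 0"
  using two_eq_0 by (metis mult_2 mult_zero_left)

lemma add_eq_0_iff_eq: "(x :: 'a) + y = 0 \<longleftrightarrow> x = y"
  by (metis add_self add_left_cancel)

text \<open>Take an additively closed set \<open>H\<close> containing 0 of the largest possible
  cardinality 2^k. If some \<open>x\<close> were outside, adjoining the translate of
  \<open>H\<close> by \<open>x\<close> would give a closed set of twice the size, since x + x =
  0.\<close>

lemma card_eq_power_2:
  obtains k where "CARD('a) = 2 ^ k"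
proof -
  define P where "P k \<longleftrightarrow>
    (\<exists>H :: 'a set. 0 \<in> H \<and> (\<forall>x\<in>H. \<forall>y\<in>H. x + y \<in> H) \<and> card H = 2 ^ k)" for k
  have "P 0" unfolding P_def by (intro exI[of _ "{0}"]) auto
  moreover have "k \<le> CARD('a)" if Pk: "P k" for k
  proof -
    obtain H :: "'a set" where "card H = 2 ^ k" using Pk unfolding P_def by blast
    then have "2 ^ k \<le> CARD('a)" by (metis card_mono finite subset_UNIV)
    then show ?thesis by (meson less_exp less_le_trans less_imp_le)
  qed
  ultimately obtain k where "P k" and max: "\<And>l. P l \<Longrightarrow> l \<le> k"
    by (metis GreatestI_nat Greatest_le_nat)
  then obtain H :: "'a set" where
    H: "0 \<in> H" "\<And>x y. x \<in> H \<Longrightarrow> y \<in> H \<Longrightarrow> x + y \<in> H" "card H = 2 ^ k"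
    by (auto simp: P_def)
  have "H = UNIV"
  proof (rule ccontr)
    assume "H \<noteq> UNIV"
    then obtain x where x: "x \<notin> H" by auto
    have shift: "x + (x + y) = y" for y by (simp add: add_self flip: add.assoc)
    have "card (H \<union> (+) x ` H) = card H + card ((+) x ` H)"
    proof (rule card_Un_disjoint)
      show "H \<inter> (+) x ` H = {}"
      proof (rule ccontr)
        assume "H \<inter> (+) x ` H \<noteq> {}"
        then obtain y where y: "y \<in> H" "x + y \<in> H" by auto
        then have "(x + y) + y \<in> H" using H by blast
        with x show False by (simp add: add.assoc add_self)
      qed
    qed auto
    also have "\<dots> = 2 ^ Suc k" using H by (simp add: card_image)
    finally have card: "card (H \<union> (+) x ` H) = 2 ^ Suc k" .
    have "y + z \<in> H \<union> (+) x ` H" if yz: "y \<in> H \<union> (+) x ` H" "z \<in> H \<union> (+) x ` H" for y z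
    proof -
      consider "y \<in> H" "z \<in> H" | z' where "y \<in> H" "z' \<in> H" "z = x + z'"
        | y' where "y' \<in> H" "z \<in> H" "y = x + y'"
        | y' z' where "y' \<in> H" "z' \<in> H" "y = x + y'" "z = x + z'"
        using yz by blast
      then show ?thesis
      proof cases
        case 2
        then show ?thesis using H(2)[of y z'] by (auto simp: image_iff add.left_commute)
      next
        case 3
        then show ?thesis using H(2)[of y' z] by (auto simp: image_iff add.assoc)
      next
        case 4
        then have "y + z = x + (x + (y' + z'))" by (simp add: ac_simps)
        then have "y + z = y' + z'" by (simp only: shift)
        moreover have "y' + z' \<in> H" using 4 H(2) by simp
        ultimately show ?thesis by simp
      qed (use H in auto)
    qed
    with H card have "P (Suc k)" unfolding P_def by (intro exI[of _ "H \<union> (+) x ` H"]) auto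
    then show False using max by fastforce
  qed
  with H that show ?thesis by auto
qed

lemma sum_square: "((x :: 'a) + y) ^ 2 = x ^ 2 + y ^ 2"
  by (simp add: power2_sum two_eq_0)

lemma sum_power_2_power: "((x :: 'a) + y) ^ (2 ^ i) = x ^ (2 ^ i) + y ^ (2 ^ i)"
proof (induction i)
  case (Suc i)
  then show ?case by (simp add: power_mult sum_square mult.commute[of 2])
qed simp

text \<open>Squaring is additive, so the sum telescopes to t^q + t, which is zero because t^q =
  t.\<close>

lemma absolute_trace2_Artin_Schreier: "absolute_trace2 ((t :: 'a) ^ 2 + t) = 0"
proof -
  obtain k where k: "CARD('a) = 2 ^ k" by (rule card_eq_power_2)
  have "k \<noteq> 0"
  proof
    assume "k = 0"
    then have "CARD('a) = 1" using k by simp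
    then show False by (metis card_1_singletonE UNIV_I singletonD zero_neq_one)
  qed
  then obtain l where l: "k = Suc l" using not0_implies_Suc by blast
  \<comment> \<open>Here \<open>k\<close> must be positive: only then is half of 2^k equal to 2^(k -
    1), so that the trace has exactly \<open>k\<close> terms.\<close>
  have "{i. 2 ^ i \<le> CARD('a) div 2} = {..<k}"
    using k l by (auto simp: less_Suc_eq_le)
  moreover have "(\<Sum>i<n. (t ^ 2 + t) ^ (2 ^ i)) = t ^ (2 ^ n) + t" for n
  proof (induction n)
    case (Suc n)
    have "(t ^ 2 + t) ^ (2 ^ n) = t ^ (2 ^ Suc n) + t ^ (2 ^ n)"
      by (simp add: sum_power_2_power flip: power_mult)
    then have "(\<Sum>i<Suc n. (t ^ 2 + t) ^ (2 ^ i)) = t ^ (2 ^ Suc n) + (t ^ (2 ^ n) + t ^ (2 ^ n)) + t"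
      using Suc by (simp add: ac_simps)
    then show ?case by (simp only: add_self add_0_right)
  qed (simp add: add_self)
  ultimately have "absolute_trace2 (t ^ 2 + t) = t ^ CARD('a) + t"
    unfolding absolute_trace2_def k by simp
  then show ?thesis by (simp add: finite_field_power_card add_self)
qed

text \<open>The form is the norm of x + w y, where w is a root of X^2 + X + sigma in the quadratic
  extension. A zero with y nonzero would write sigma as s^2 + s with s = x/y, contradicting trace
  one.\<close>

lemma norm_form_anisotropic:
  assumes "absolute_trace2 \<sigma> = 1" "(x :: 'a) ^ 2 + x * y + \<sigma> * y ^ 2 = 0"
  shows "x = 0 \<and> y = 0"
proof (cases "y = 0")
  case False
  have "(x / y) ^ 2 + x / y + \<sigma> = 0"
    using assms(2) False by (simp add: field_simps power2_eq_square)
  then have "\<sigma> = (x / y) ^ 2 + x / y" by (simp add: add_eq_0_iff_eq)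
  then show ?thesis using assms(1) absolute_trace2_Artin_Schreier by simp
qed (use assms in auto)

text \<open>A non-square power of 2 is 2 times a power of 4, hence congruent to 2 modulo 3. Then z =
  z^q = z^2.\<close>

lemma cube_root_of_unity_eq_1:
  assumes "\<not> is_square CARD('a)" "(z :: 'a) ^ 3 = 1"
  shows "z = 1"
proof -
  obtain k where k: "CARD('a) = 2 ^ k" by (rule card_eq_power_2)
  have "odd k"
  proof
    assume "even k"
    then have "CARD('a) = (2 ^ (k div 2)) ^ 2" using k by (simp flip: power_mult)
    with assms show False by (simp add: is_nth_power_def)
  qed
  then have "CARD('a) = 2 * 4 ^ (k div 2)"
    using k by (auto elim!: oddE simp: power_mult)
  moreover have "(4 :: nat) ^ n mod 3 = 1" for n
  proof (induction n)
    case (Suc n)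
    then show ?case unfolding power_Suc by presburger
  qed simp
  ultimately have "CARD('a) mod 3 = 2" 
    by (metis mod_mult_right_eq mult_1_right one_add_one mod_less numeral_2_eq_2 numeral_3_eq_3 lessI)
  then obtain n where "CARD('a) = 3 * n + 2" by (metis mult_div_mod_eq)
  then have "z = z ^ (3 * n + 2)" by (metis finite_field_power_card)
  also have "\<dots> = z ^ 2" using assms(2) by (simp add: power_add power_mult power2_eq_square)
  finally have "z = z ^ 2" .
  moreover have "z \<noteq> 0" using assms by auto
  ultimately show ?thesis by (simp add: power2_eq_square)
qed

end

text \<open>On a finite set a map that is not surjective is not injective, so a non-cube produces
  two elements with equal cubes. Their quotient w is a nontrivial cube root of unity, and 1, w, w^2
  are all of them.\<close>

lemma card_cube_roots_of_unity:
  fixes \<theta> :: "'a::{field, finite}"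
  assumes "\<not> is_nth_power 3 \<theta>"
  shows "card {z :: 'a. z ^ 3 = 1} = 3"
proof -
  have "\<not> surj (\<lambda>x :: 'a. x ^ 3)" using assms by (metis is_nth_power_nth_power surjD)
  then have "\<not> inj (\<lambda>x :: 'a. x ^ 3)" 
    using finite_UNIV_inj_surj[OF finite, of "\<lambda>x :: 'a. x ^ 3"] by blast
  then obtain x y :: 'a where xy: "x \<noteq> y" "x ^ 3 = y ^ 3" by (auto simp: inj_def)
  then have "y \<noteq> 0" by auto
  define w where "w = x / y"
  have w: "w \<noteq> 1" "w ^ 3 = 1" using xy \<open>y \<noteq> 0\<close> by (auto simp: w_def power_divide)
  then have "w \<noteq> 0" by auto
  have "(w - 1) * (w ^ 2 + w + 1) = 0" using w by algebra
  then have w2: "w ^ 2 + w + 1 = 0" using w by simp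
  have "z ^ 3 = 1 \<longleftrightarrow> z \<in> {1, w, w ^ 2}" for z
  proof -
    have "z ^ 3 - 1 = (z - 1) * ((z - w) * (z - w ^ 2))" using w2 by algebra
    then show ?thesis by (metis eq_iff_diff_eq_0 insert_iff mult_eq_0_iff singletonD)
  qed
  then have "{z. z ^ 3 = 1} = {1, w, w ^ 2}" by blast
  moreover have "w \<noteq> w ^ 2" using w \<open>w \<noteq> 0\<close> by (simp add: power2_eq_square)
  moreover have "1 \<noteq> w ^ 2"
  proof
    assume "1 = w ^ 2"
    then have "w = 1" using w(2) by (simp add: power3_eq_cube power2_eq_square)
    with w show False by simp
  qed
  moreover have "1 \<noteq> w" using w by simp
  ultimately show ?thesis by simp
qed

subsection \<open>Stabilizers of the normal forms\<close>

lemma cubicsI: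
  assumes "u * g + v * h = [:k:]" "k \<noteq> 0" "h \<noteq> 0" "max (degree g) (degree h) = 3"
  shows "Fract g h \<in> cubics"
  using rat_degree_eq[OF lowest_terms_FractI[OF assms(1-3)]] assms(4) by (simp add: cubics_def)

definition in_span :: "'a::field poly \<Rightarrow> 'a poly \<Rightarrow> 'a poly \<Rightarrow> bool" where
  "in_span g h p \<longleftrightarrow> (\<exists>\<alpha> \<beta>. p = smult \<alpha> g + smult \<beta> h)"

definition stabilizing_matrices :: "'a::field poly \<Rightarrow> 'a poly \<Rightarrow> ('a \<times> 'a \<times> 'a \<times> 'a) set" where
  "stabilizing_matrices g h = {(a, b, c, d) \<in> GL2.
     in_span g h (homogenize 3 g [:b, a:] [:d, c:]) \<and>
     in_span g h (homogenize 3 h [:b, a:] [:d, c:])}"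

text \<open>The right-hand side is the squared order of \<open>PGL2\<close>, times the q - 1 scalar
  multiples that each stabilizing substitution contributes as matrices.\<close>

lemma card_cubics_equivalent_to:
  fixes g h :: "'a::{field, finite} poly"
  assumes S: "Fract g h \<in> cubics" "degree g \<le> 3" "degree h \<le> 3" "h \<noteq> 0"
  defines "q \<equiv> real CARD('a)"
  shows "real (card (cubics_equivalent_to (Fract g h))) * real (card (stabilizing_matrices g h))
    = q ^ 2 * (q ^ 2 - 1) ^ 2 * (q - 1)"
proof -
  let ?C = "{A \<in> carrier PGL2. \<exists>B\<in>carrier PGL2. rat_comp B (Fract g h) = rat_comp (Fract g h) A}"
  have "stabilizing_matrices g h = {m \<in> GL2. \<exists>B\<in>carrier PGL2.
      rat_comp B (Fract g h) = rat_comp (Fract g h) (mobius m)}"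
  proof -
    have "(a, b, c, d) \<in> stabilizing_matrices g h \<longleftrightarrow> (a, b, c, d) \<in> GL2 \<and>
        (\<exists>B\<in>carrier PGL2. rat_comp B (Fract g h) = rat_comp (Fract g h) (mobius (a, b, c, d)))" for a b c d
      unfolding stabilizing_matrices_def in_span_def
      using ex_PGL2_left_iff[OF S S, of a b c d] by blast
    then show ?thesis by (simp only: set_eq_iff split_paired_All mem_Collect_eq simp_thms)
  qed
  then have "card (stabilizing_matrices g h) = (CARD('a) - 1) * card ?C"
    using card_GL2_mobius[of "\<lambda>A. \<exists>B\<in>carrier PGL2. rat_comp B (Fract g h) = rat_comp (Fract g h) A"]
    by simp
  moreover have "real (CARD('a) - 1) = q - 1"
    using card_field_ge_2[where 'a='a] by (simp add: q_def of_nat_diff)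
  ultimately have "real (card (stabilizing_matrices g h)) = (q - 1) * real (card ?C)" by simp
  moreover have "real (card (cubics_equivalent_to (Fract g h))) * real (card ?C) = (q ^ 3 - q) ^ 2"
    using orbit_stabilizer_cubics[OF S(1), THEN arg_cong[of _ _ real]]
      card_PGL2[where 'a='a] by (simp add: q_def)
  ultimately have "real (card (cubics_equivalent_to (Fract g h))) *
      real (card (stabilizing_matrices g h)) = (q ^ 3 - q) ^ 2 * (q - 1)" by simp
  also have "(q ^ 3 - q) ^ 2 = q ^ 2 * (q ^ 2 - 1) ^ 2" by algebra
  finally show ?thesis .
qed

context
  assumes char2: "CHAR('a::{field, finite}) = 2"
begin

text \<open>In characteristic two the middle term of a square disappears and the binomial
  coefficient 3 becomes 1, so every monomial has coefficient one.\<close>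

lemma homogenize_cubic:
  "homogenize 3 [:g0, g1, g2, g3:] [:b, a:] [:d, c :: 'a:] =
    [:g0 * d ^ 3 + g1 * b * d ^ 2 + g2 * b ^ 2 * d + g3 * b ^ 3,
      g0 * c * d ^ 2 + g1 * a * d ^ 2 + g2 * b ^ 2 * c + g3 * a * b ^ 2,
      g0 * c ^ 2 * d + g1 * b * c ^ 2 + g2 * a ^ 2 * d + g3 * a ^ 2 * b,
      g0 * c ^ 3 + g1 * a * c ^ 2 + g2 * a ^ 2 * c + g3 * a ^ 3:]"
proof -
  have sq: "[:x, y:] ^ 2 = [:x ^ 2, 0, y ^ 2 :: 'a:]" for x y
    by (simp add: power2_eq_square algebra_simps add_self[OF char2])
  have "(3 :: 'a) = 2 + 1" by simp
  then have three: "(3 :: 'a) = 1" by (simp add: two_eq_0[OF char2] del: one_add_one)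
  have cube: "[:x, y:] ^ 3 = [:x ^ 3, x ^ 2 * y, x * y ^ 2, y ^ 3 :: 'a:]" for x y
    by (simp add: power3_eq_cube[of "[:x, y:]"] flip: power2_eq_square)
      (simp add: sq three power2_eq_square power3_eq_cube algebra_simps)
  have "homogenize 3 [:g0, g1, g2, g3:] p r =
      smult g0 (r ^ 3) + smult g1 (p * r ^ 2) + smult g2 (p ^ 2 * r) + smult g3 (p ^ 3)" for p r
    by (simp add: homogenize_def eval_nat_numeral algebra_simps)
  then show ?thesis
    by (simp add: sq cube)
qed

end

lemma mem_stabilizing_matrices:
  "(a, b, c, d) \<in> stabilizing_matrices g h \<longleftrightarrow> a * d \<noteq> b * c \<and>
     in_span g h (homogenize 3 g [:b, a:] [:d, c:]) \<and>
     in_span g h (homogenize 3 h [:b, a:] [:d, c:])"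
  by (simp add: stabilizing_matrices_def GL2_def)

lemma card_UNIV_minus_0: "card (UNIV - {0 :: 'a::{field, finite}}) = CARD('a) - 1"
  by (simp add: card_Diff_singleton)

section \<open>The normal forms without sigma\<close>

context
  assumes char2: "CHAR('a::{field, finite}) = 2"
begin

lemma homogenize_1_cubic: "homogenize 3 1 [:b, a:] [:d, c :: 'a:] = [:d ^ 3, c * d ^ 2, c ^ 2 * d, c ^ 3:]"
  using homogenize_cubic[OF char2, of 1 0 0 0 b a d c] by (simp add: one_pCons)

text \<open>Only the multiples of x^3 and y^3 in the plane have a repeated factor, so 0 and infinity
  are both fixed or exchanged: the matrices are diagonal or antidiagonal.\<close>

lemma card_stabilizing_matrices_cube:
  "card (stabilizing_matrices [:0, 0, 0, 1:] (1 :: 'a poly)) = 2 * (CARD('a) - 1) ^ 2"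
proof -
  let ?U = "UNIV - {0 :: 'a}"
  have span: "in_span [:0, 0, 0, 1:] 1 [:p0, p1, p2, p3 :: 'a:] \<longleftrightarrow> p1 = 0 \<and> p2 = 0" for p0 p1 p2 p3
    by (auto simp: in_span_def one_pCons)
  have mem: "(a, b, c, d) \<in> stabilizing_matrices [:0, 0, 0, 1:] 1
      \<longleftrightarrow> a * d \<noteq> b * c \<and> a * b = 0 \<and> c * d = 0" for a b c d :: 'a
    by (auto simp: mem_stabilizing_matrices homogenize_cubic[OF char2] homogenize_1_cubic span)
  have eq: "stabilizing_matrices [:0, 0, 0, 1:] (1 :: 'a poly)
      = (\<lambda>(a, d). (a, 0, 0, d)) ` (?U \<times> ?U) \<union> (\<lambda>(b, c). (0, b, c, 0)) ` (?U \<times> ?U)"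
    by (auto simp: mem image_iff)
  have "card (stabilizing_matrices [:0, 0, 0, 1:] (1 :: 'a poly))
      = card ((\<lambda>(a :: 'a, d :: 'a). (a, 0 :: 'a, 0 :: 'a, d)) ` (?U \<times> ?U))
      + card ((\<lambda>(b :: 'a, c :: 'a). (0 :: 'a, b, c, 0 :: 'a)) ` (?U \<times> ?U))"
    unfolding eq by (rule card_Un_disjoint) auto
  also have "\<dots> = card (?U \<times> ?U) + card (?U \<times> ?U)"
  proof -
    have "inj_on (\<lambda>(a :: 'a, d :: 'a). (a, 0 :: 'a, 0 :: 'a, d)) (?U \<times> ?U)"
      "inj_on (\<lambda>(b :: 'a, c :: 'a). (0 :: 'a, b, c, 0 :: 'a)) (?U \<times> ?U)"
      by (auto simp: inj_on_def)
    then show ?thesis by (simp only: card_image)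
  qed
  also have "\<dots> = 2 * (CARD('a) - 1) ^ 2"
    by (simp only: card_cartesian_product card_UNIV_minus_0 power2_eq_square mult_2)
  finally show ?thesis .
qed

lemma card_scalar_matrices: "card ((\<lambda>a :: 'a. (a, 0 :: 'a, 0 :: 'a, a)) ` (UNIV - {0})) = CARD('a) - 1"
  by (simp add: card_image inj_on_def card_UNIV_minus_0)

text \<open>The special members are y^3 and x^2 (x + y), up to scalars. A stabilizing substitution
  fixes infinity, the double root 0 and the simple root 1, hence is the identity.\<close>

lemma card_stabilizing_matrices_cube_plus_square:
  "card (stabilizing_matrices [:0, 0, 1, 1:] (1 :: 'a poly)) = CARD('a) - 1"
proof -
  have span: "in_span [:0, 0, 1, 1:] 1 [:p0, p1, p2, p3 :: 'a:] \<longleftrightarrow> p1 = 0 \<and> p2 = p3" for p0 p1 p2 p3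
    by (auto simp: in_span_def one_pCons)
  have "(a, b, c, d) \<in> stabilizing_matrices [:0, 0, 1, 1:] 1
      \<longleftrightarrow> a \<noteq> 0 \<and> b = 0 \<and> c = 0 \<and> d = a" for a b c d :: 'a
    by (auto simp: mem_stabilizing_matrices homogenize_cubic[OF char2] homogenize_1_cubic span
        power2_eq_square power3_eq_cube)
  then have "stabilizing_matrices [:0, 0, 1, 1:] 1 = (\<lambda>a :: 'a. (a, 0, 0, a)) ` (UNIV - {0})"
    by auto
  then show ?thesis by (simp only: card_scalar_matrices)
qed

lemma in_span_cube_plus_over_X:
  "in_span [:t, 0, 0, 1:] [:0, 1:] [:p0, p1, p2, p3 :: 'a:] \<longleftrightarrow> p2 = 0 \<and> p0 = t * p3"
  by (auto simp: in_span_def mult.commute)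

text \<open>Up to scalars x y^2 is the only member with a repeated factor in either plane, so the
  substitution fixes infinity and 0 and is diagonal. The case s = t yields the stabilizer, and the
  case of different parameters decides when two of these forms are equivalent.\<close>

lemma cube_plus_over_X_transport:
  assumes "t \<noteq> 0" "a * d \<noteq> b * (c :: 'a)"
    "in_span [:t, 0, 0, 1:] [:0, 1:] (homogenize 3 [:s, 0, 0, 1:] [:b, a:] [:d, c:])"
    "in_span [:t, 0, 0, 1:] [:0, 1:] (homogenize 3 [:0, 1:] [:b, a:] [:d, c:])"
  shows "b = 0 \<and> c = 0 \<and> a \<noteq> 0 \<and> s * d ^ 3 = t * a ^ 3"
proof -
  have H: "b * c ^ 2 = 0" "b * d ^ 2 = t * (a * c ^ 2)"
    using assms(4) homogenize_cubic[OF char2, of 0 1 0 0 b a d c]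
    by (simp_all add: in_span_cube_plus_over_X)
  have G: "s * d ^ 3 + b ^ 3 = t * (s * c ^ 3 + a ^ 3)"
    using assms(3) homogenize_cubic[OF char2, of s 0 0 1 b a d c]
    by (simp add: in_span_cube_plus_over_X)
  have "c = 0"
  proof (rule ccontr)
    assume "c \<noteq> 0"
    with H have "b = 0" "a = 0" using assms(1) by auto
    with assms(2) show False by simp
  qed
  with H assms(2) have "b = 0" by auto
  with \<open>c = 0\<close> G assms(2) show ?thesis by simp
qed

lemma card_stabilizing_matrices_cube_plus_over_X:
  assumes "t \<noteq> (0 :: 'a)"
  shows "card (stabilizing_matrices [:t, 0, 0, 1:] [:0, 1:])
    = (CARD('a) - 1) * card {z :: 'a. z ^ 3 = 1}"
proof -
  have hom: "homogenize 3 [:0, 1:] [:b, a:] [:d, c :: 'a:] = [:b * d ^ 2, a * d ^ 2, b * c ^ 2, a * c ^ 2:]"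
    for a b c d using homogenize_cubic[OF char2, of 0 1 0 0 b a d c] by simp
  have mem: "(a, b, c, d) \<in> stabilizing_matrices [:t, 0, 0, 1:] [:0, 1:] \<longleftrightarrow> a * d \<noteq> b * c \<and>
      (t * c ^ 2 * d + a ^ 2 * b = 0 \<and> t * d ^ 3 + b ^ 3 = t * (t * c ^ 3 + a ^ 3)) \<and>
      b * c ^ 2 = 0 \<and> b * d ^ 2 = t * (a * c ^ 2)" for a b c d
    by (simp add: mem_stabilizing_matrices hom homogenize_cubic[OF char2] in_span_cube_plus_over_X)
  let ?U = "UNIV - {0 :: 'a}" and ?R = "{z :: 'a. z ^ 3 = 1}"
  have "stabilizing_matrices [:t, 0, 0, 1:] [:0, 1:] = (\<lambda>(d, z). (d * z, 0, 0, d)) ` (?U \<times> ?R)"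
  proof (intro equalityI subsetI)
    fix x :: "'a \<times> 'a \<times> 'a \<times> 'a" assume x: "x \<in> stabilizing_matrices [:t, 0, 0, 1:] [:0, 1:]"
    obtain a b c d where abcd: "x = (a, b, c, d)" by (metis surj_pair)
    with x have det: "a * d \<noteq> b * c" by (simp add: mem_stabilizing_matrices)
    with cube_plus_over_X_transport[OF assms det, of t] x abcd
    have "b = 0" "c = 0" "t * d ^ 3 = t * a ^ 3" by (simp_all add: mem_stabilizing_matrices)
    moreover from this det have "d \<noteq> 0" by auto
    ultimately have "x = (\<lambda>(d, z). (d * z, 0, 0, d)) (d, a / d)" "(d, a / d) \<in> ?U \<times> ?R"
      using assms abcd by (auto simp: power_divide)
    then show "x \<in> (\<lambda>(d, z). (d * z, 0, 0, d)) ` (?U \<times> ?R)" by (rule image_eqI)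
  next
    fix x :: "'a \<times> 'a \<times> 'a \<times> 'a" assume "x \<in> (\<lambda>(d, z). (d * z, 0, 0, d)) ` (?U \<times> ?R)"
    then obtain d z where "x = (d * z, 0, 0, d)" "d \<noteq> 0" "z ^ 3 = 1" by auto
    then show "x \<in> stabilizing_matrices [:t, 0, 0, 1:] [:0, 1:]"
      by (auto simp: mem power_mult_distrib)
  qed
  moreover have "inj_on (\<lambda>(d, z). (d * z, 0 :: 'a, 0 :: 'a, d)) (?U \<times> ?R)"
    by (auto simp: inj_on_def)
  ultimately show ?thesis by (simp add: card_image card_cartesian_product card_UNIV_minus_0)
qed

text \<open>The members with a repeated factor are y^2 (x + c0 y) and, as the sum of the two
  generators, x (x + y)^2. The nontrivial stabilizing substitution x -> (x + c0)/(x + 1) exchanges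
  the double roots infinity and 1 together with the simple roots \<open>c0\<close> and 0.\<close>

lemma card_stabilizing_matrices_cube_plus_over_plus:
  assumes c0: "c0 \<notin> {0, 1 :: 'a}"
  shows "card (stabilizing_matrices [:c0, 0, 0, 1:] [:c0, 1:]) = 2 * (CARD('a) - 1)"
proof -
  note two = two_eq_0[OF char2] and self = add_self[OF char2] and eq0 = add_eq_0_iff_eq[OF char2]
  have hom: "homogenize 3 [:c0, 1:] [:b, a:] [:d, c :: 'a:]
      = [:(c0 * d + b) * d ^ 2, (c0 * c + a) * d ^ 2, (c0 * d + b) * c ^ 2, (c0 * c + a) * c ^ 2:]"
    for a b c d
    using homogenize_cubic[OF char2, of c0 1 0 0 b a d c]
    by (simp add: algebra_simps power2_eq_square power3_eq_cube)
  have span: "in_span [:c0, 0, 0, 1:] [:c0, 1:] [:p0, p1, p2, p3 :: 'a:]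
      \<longleftrightarrow> p2 = 0 \<and> p0 = c0 * (p1 + p3)" for p0 p1 p2 p3
    by (auto simp: in_span_def algebra_simps)
  let ?U = "UNIV - {0 :: 'a}"
  have mem0: "(a, b, c, d) \<in> stabilizing_matrices [:c0, 0, 0, 1:] [:c0, 1:] \<longleftrightarrow> a * d \<noteq> b * c \<and>
      (c0 * c ^ 2 * d + a ^ 2 * b = 0 \<and>
        c0 * d ^ 3 + b ^ 3 = c0 * ((c0 * c * d ^ 2 + a * b ^ 2) + (c0 * c ^ 3 + a ^ 3))) \<and>
      (c0 * d + b) * c ^ 2 = 0 \<and>
      (c0 * d + b) * d ^ 2 = c0 * ((c0 * c + a) * d ^ 2 + (c0 * c + a) * c ^ 2)" for a b c d
    by (simp only: mem_stabilizing_matrices hom span homogenize_cubic[OF char2] mult_1_left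
        mult_zero_left add_0_right)
  have mem: "(a, b, c, d) \<in> stabilizing_matrices [:c0, 0, 0, 1:] [:c0, 1:] \<longleftrightarrow>
      (a \<noteq> 0 \<and> b = 0 \<and> c = 0 \<and> d = a) \<or> (a \<noteq> 0 \<and> b = c0 * a \<and> c = a \<and> d = a)"
    (is "?L \<longleftrightarrow> ?R") for a b c d :: 'a
  proof
    assume ?L
    then have det: "a * d \<noteq> b * c"
      and H2: "(c0 * d + b) * c ^ 2 = 0"
      and H0: "(c0 * d + b) * d ^ 2 = c0 * ((c0 * c + a) * d ^ 2 + (c0 * c + a) * c ^ 2)"
      and G2: "c0 * c ^ 2 * d + a ^ 2 * b = 0"
      by (simp_all add: mem0)
    show ?R
    proof (cases "c = 0")
      case True
      with G2 det have "b = 0" by auto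
      with True H0 det have "d = a" using c0 by auto
      with True \<open>b = 0\<close> det show ?thesis by auto
    next
      \<comment> \<open>Infinity is moved here, and the first relation already forces 0 to go to
        \<open>c0\<close>.\<close>
      case False
      with H2 have b: "b = c0 * d" by (auto simp: eq0)
      have "a + c0 * c \<noteq> 0" using det by (auto simp: b eq0 ac_simps)
      moreover have "c0 * ((a + c0 * c) * (c + d) ^ 2) = 0"
        using H0 by (simp add: b self sum_square[OF char2] algebra_simps)
      ultimately have d: "d = c" using c0 by (auto simp: eq0)
      have "c0 * c ^ 2 * c + a ^ 2 * (c0 * c) = 0" using G2 by (simp only: b d)
      \<comment> \<open>The two terms share the factor \<open>c0 * c\<close>, and a^2 + c^2 is a
        square in characteristic two.\<close>
      then have "c0 * c * (a + c) ^ 2 = 0" unfolding sum_square[OF char2] by algebra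
      then have "a = c" using c0 False by (auto simp: eq0)
      with d b False show ?thesis by auto
    qed
  next
    assume ?R
    then show ?L
    proof
      assume "a \<noteq> 0 \<and> b = 0 \<and> c = 0 \<and> d = a"
      then show ?L
        by (simp add: mem0 power2_eq_square power3_eq_cube)
    next
      assume eq: "a \<noteq> 0 \<and> b = c0 * a \<and> c = a \<and> d = a"
      have "a * a \<noteq> c0 * a * a" using eq c0 by simp
      moreover have "c0 * a ^ 3 + (c0 * a) ^ 3
          = c0 * ((c0 * a * a ^ 2 + a * (c0 * a) ^ 2) + (c0 * a ^ 3 + a ^ 3))"
        by (simp add: two algebra_simps power2_eq_square power3_eq_cube)
      moreover have "c0 * a ^ 2 * a + a ^ 2 * (c0 * a) = 0"
        by (simp add: two algebra_simps power2_eq_square power3_eq_cube)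
      ultimately have "(a, c0 * a, a, a) \<in> stabilizing_matrices [:c0, 0, 0, 1:] [:c0, 1:]"
        unfolding mem0 by (simp only: self mult_zero_left mult_zero_right simp_thms)
      then show ?L using eq by simp
    qed
  qed
  have eq: "stabilizing_matrices [:c0, 0, 0, 1:] [:c0, 1:]
      = (\<lambda>a. (a, 0, 0, a)) ` ?U \<union> (\<lambda>a. (a, c0 * a, a, a)) ` ?U"
    by (auto simp: mem image_iff)
  have "card (stabilizing_matrices [:c0, 0, 0, 1:] [:c0, 1:])
      = card ((\<lambda>a :: 'a. (a, 0 :: 'a, 0 :: 'a, a)) ` ?U)
        + card ((\<lambda>a. (a, c0 * a, a, a)) ` ?U)"
    unfolding eq by (rule card_Un_disjoint) auto
  also have "\<dots> = 2 * (CARD('a) - 1)"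
    by (simp add: card_scalar_matrices card_image inj_on_def card_UNIV_minus_0)
  finally show ?thesis .
qed

end

section \<open>The normal forms with sigma, as one family: e = 0 is case (ii) and e = b is case
  (vi)\<close>

definition twisted_num :: "'a::field \<Rightarrow> 'a \<Rightarrow> 'a poly" where
  "twisted_num \<sigma> e = [:(e + 1) * \<sigma>, \<sigma>, e, 1:]"

definition twisted_den :: "'a::field \<Rightarrow> 'a \<Rightarrow> 'a poly" where
  "twisted_den \<sigma> e = [:e + 1 + \<sigma>, 1, 1:]"

context
  assumes char2: "CHAR('a::{field, finite}) = 2"
begin

text \<open>Used as rewrite rules, these collapse the integer coefficients that expansion creates,
  so polynomial identities modulo 2 can be checked by normalization.\<close>

lemma numeral_char2: "(numeral (Num.Bit0 k) :: 'a) = 0" "(numeral (Num.Bit1 k) :: 'a) = 1"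
  by (simp_all only: numeral_Bit0 numeral_Bit1 add_self[OF char2] add_0_left)

text \<open>The coefficients of x^3 and x^2 force the combination: p3 times the numerator plus p2 +
  e p3 times the denominator. The two conditions compare the remaining coefficients.\<close>

lemma in_span_twisted:
  "in_span (twisted_num \<sigma> e) (twisted_den \<sigma> e) [:p0, p1, p2, p3 :: 'a:] \<longleftrightarrow>
    p1 + \<sigma> * p3 + p2 + e * p3 = 0 \<and>
    p0 + (e + 1) * \<sigma> * p3 + (e + 1 + \<sigma>) * (p2 + e * p3) = 0" (is "?L \<longleftrightarrow> ?R")
proof
  assume ?L
  then obtain \<alpha> \<beta> where "p0 = \<alpha> * ((e + 1) * \<sigma>) + \<beta> * (e + 1 + \<sigma>)" "p1 = \<alpha> * \<sigma> + \<beta>"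
      "p2 = \<alpha> * e + \<beta>" "p3 = \<alpha>"
    by (auto simp: in_span_def twisted_num_def twisted_den_def)
  then show ?R by (simp add: numeral_char2 algebra_simps)
next
  assume R: ?R
  have "p2 = p3 * e + (p2 + e * p3)" by (simp add: numeral_char2 algebra_simps)
  moreover have "p1 = p3 * \<sigma> + (p2 + e * p3)"
    using R by (simp add: add_eq_0_iff_eq[OF char2] add.assoc mult.commute)
  moreover have "p0 = p3 * ((e + 1) * \<sigma>) + (p2 + e * p3) * (e + 1 + \<sigma>)"
    using R by (simp add: add_eq_0_iff_eq[OF char2] add.assoc mult.commute)
  ultimately show ?L unfolding in_span_def twisted_num_def twisted_den_def
    by (intro exI[of _ p3] exI[of _ "p2 + e * p3"]) (simp add: mult.commute)
qed

text \<open>The two equations are the coordinates of (s + t w)(x + y w) = 0 with w^2 = w + sigma,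
  and the extension has no zero divisors.\<close>

lemma norm_form_mult_eq_0:
  assumes "absolute_trace2 \<sigma> = 1" "(s :: 'a) * x + \<sigma> * t * y = 0" "s * y + t * x + t * y = 0"
  shows "(s = 0 \<and> t = 0) \<or> (x = 0 \<and> y = 0)"
proof (cases "s ^ 2 + s * t + \<sigma> * t ^ 2 = 0")
  case True
  then show ?thesis using norm_form_anisotropic[OF char2 assms(1)] by blast
next
  case False
  \<comment> \<open>Multiplication by the conjugate (s + t) + t w turns the first factor into its
    norm.\<close>
  have "(s ^ 2 + s * t + \<sigma> * t ^ 2) * x
      = (s + t) * (s * x + \<sigma> * t * y) + \<sigma> * t * (s * y + t * x + t * y)"
    by (simp add: numeral_char2 algebra_simps power2_eq_square)
  moreover have "(s ^ 2 + s * t + \<sigma> * t ^ 2) * y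
      = t * (s * x + \<sigma> * t * y) + s * (s * y + t * x + t * y)"
    by (simp add: numeral_char2 algebra_simps power2_eq_square)
  ultimately have "(s ^ 2 + s * t + \<sigma> * t ^ 2) * x = 0" "(s ^ 2 + s * t + \<sigma> * t ^ 2) * y = 0"
    by (simp_all only: assms(2,3) mult_zero_right add_0_left)
  then show ?thesis using False by (simp only: mult_eq_0_iff simp_thms)
qed

(* Let w be a root of X^2 + X + sigma and z = x + w y, with conjugate z'. Numerator + w denominator is
   z^2 ((1 + e) z + e z'), and the substitution x -> a x + b y, y -> c x + d y maps z to
   alpha z + beta z' with alpha = (a + b + sigma c) + (a + d) w, beta = (b + sigma c) + (a + c + d) w.
   The image is again in the span iff two of its coefficient relations hold; these read
   alpha^2 X = 0 and beta^2 Y = 0 with X, Y the linear forms written out by coordinates below. *)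
lemma twisted_stabilizer_cases:
  fixes a b c d e \<sigma> :: 'a
  assumes \<sigma>: "absolute_trace2 \<sigma> = 1"
    and mem: "(a, b, c, d) \<in> stabilizing_matrices (twisted_num \<sigma> e) (twisted_den \<sigma> e)"
  defines "\<alpha>0 \<equiv> a + b + \<sigma> * c" and "\<alpha>1 \<equiv> a + d"
    and "\<beta>0 \<equiv> b + \<sigma> * c" and "\<beta>1 \<equiv> a + c + d"
  shows "(\<alpha>0 = 0 \<and> \<alpha>1 = 0) \<or> (e * (1 + e) * \<alpha>1 + e ^ 2 * \<beta>1 + \<beta>0 = 0 \<and> \<beta>1 = 0)"
    and "(\<beta>0 = 0 \<and> \<beta>1 = 0) \<or> (\<alpha>0 + e ^ 2 * \<alpha>1 + e * (1 + e) * \<beta>1 = 0 \<and> \<alpha>1 = 0)"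
proof -
  define G0 where "G0 = (e + 1) * \<sigma> * d ^ 3 + \<sigma> * b * d ^ 2 + e * b ^ 2 * d + b ^ 3"
  define G1 where "G1 = (e + 1) * \<sigma> * c * d ^ 2 + \<sigma> * a * d ^ 2 + e * b ^ 2 * c + a * b ^ 2"
  define G2 where "G2 = (e + 1) * \<sigma> * c ^ 2 * d + \<sigma> * b * c ^ 2 + e * a ^ 2 * d + a ^ 2 * b"
  define G3 where "G3 = (e + 1) * \<sigma> * c ^ 3 + \<sigma> * a * c ^ 2 + e * a ^ 2 * c + a ^ 3"
  define H0 where "H0 = (e + 1 + \<sigma>) * d ^ 3 + b * d ^ 2 + b ^ 2 * d"
  define H1 where "H1 = (e + 1 + \<sigma>) * c * d ^ 2 + a * d ^ 2 + b ^ 2 * c"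
  define H2 where "H2 = (e + 1 + \<sigma>) * c ^ 2 * d + b * c ^ 2 + a ^ 2 * d"
  define H3 where "H3 = (e + 1 + \<sigma>) * c ^ 3 + a * c ^ 2 + a ^ 2 * c"
  define L1 where "L1 p1 p2 p3 = p1 + \<sigma> * p3 + p2 + e * p3" for p1 p2 p3
  define L0 where "L0 p0 p2 p3 = p0 + (e + 1) * \<sigma> * p3 + (e + 1 + \<sigma>) * (p2 + e * p3)" for p0 p2 p3
  have "homogenize 3 (twisted_num \<sigma> e) [:b, a:] [:d, c:] = [:G0, G1, G2, G3:]"
    unfolding twisted_num_def homogenize_cubic[OF char2] G0_def G1_def G2_def G3_def by simp
  moreover have "homogenize 3 (twisted_den \<sigma> e) [:b, a:] [:d, c:] = [:H0, H1, H2, H3:]"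
    using homogenize_cubic[OF char2, of "e + 1 + \<sigma>" 1 1 0 b a d c]
    by (simp add: twisted_den_def H0_def H1_def H2_def H3_def)
  ultimately have L: "L1 G1 G2 G3 = 0" "L0 G0 G2 G3 = 0" "L1 H1 H2 H3 = 0" "L0 H0 H2 H3 = 0"
    using mem by (simp_all add: mem_stabilizing_matrices in_span_twisted L1_def L0_def)
  note defs = L1_def L0_def G0_def G1_def G2_def G3_def H0_def H1_def H2_def H3_def
    \<alpha>0_def \<alpha>1_def \<beta>0_def \<beta>1_def
  \<comment> \<open>The square of alpha has coordinates
    \<open>\<alpha>0 ^ 2 + \<sigma> * \<alpha>1 ^ 2\<close> and \<open>\<alpha>1 ^ 2\<close>. Modulo
    2 each coordinate of alpha^2 X equals the bracketed combination of the span relations, all of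
    which vanish by \<open>L\<close>.\<close>
  have "(\<alpha>0 ^ 2 + \<sigma> * \<alpha>1 ^ 2) * (e * (1 + e) * \<alpha>1 + e ^ 2 * \<beta>1 + \<beta>0) + \<sigma> * \<alpha>1 ^ 2 * \<beta>1
      + (e * L1 G1 G2 G3 + \<sigma> * L1 H1 H2 H3 + L0 G0 G2 G3) = 0"
    unfolding defs by (simp add: numeral_char2 algebra_simps power2_eq_square power3_eq_cube)
  moreover have "(\<alpha>0 ^ 2 + \<sigma> * \<alpha>1 ^ 2) * \<beta>1 + \<alpha>1 ^ 2 * (e * (1 + e) * \<alpha>1 + e ^ 2 * \<beta>1 + \<beta>0) + \<alpha>1 ^ 2 * \<beta>1
      + (L1 G1 G2 G3 + (e + 1) * L1 H1 H2 H3 + L0 H0 H2 H3) = 0"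
    unfolding defs by (simp add: numeral_char2 algebra_simps power2_eq_square power3_eq_cube)
  ultimately have "\<alpha>0 ^ 2 + \<sigma> * \<alpha>1 ^ 2 = 0 \<and> \<alpha>1 ^ 2 = 0 \<or>
      e * (1 + e) * \<alpha>1 + e ^ 2 * \<beta>1 + \<beta>0 = 0 \<and> \<beta>1 = 0"
    using L norm_form_mult_eq_0[OF \<sigma>, of "\<alpha>0 ^ 2 + \<sigma> * \<alpha>1 ^ 2" _ "\<alpha>1 ^ 2" \<beta>1] by simp
  then show "(\<alpha>0 = 0 \<and> \<alpha>1 = 0) \<or> (e * (1 + e) * \<alpha>1 + e ^ 2 * \<beta>1 + \<beta>0 = 0 \<and> \<beta>1 = 0)" by auto
  have "(\<beta>0 ^ 2 + \<sigma> * \<beta>1 ^ 2) * (\<alpha>0 + e ^ 2 * \<alpha>1 + e * (1 + e) * \<beta>1) + \<sigma> * \<beta>1 ^ 2 * \<alpha>1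
      + ((e + 1) * L1 G1 G2 G3 + \<sigma> * L1 H1 H2 H3 + L0 G0 G2 G3) = 0"
    unfolding defs by (simp add: numeral_char2 algebra_simps power2_eq_square power3_eq_cube)
  moreover have "(\<beta>0 ^ 2 + \<sigma> * \<beta>1 ^ 2) * \<alpha>1 + \<beta>1 ^ 2 * (\<alpha>0 + e ^ 2 * \<alpha>1 + e * (1 + e) * \<beta>1) + \<beta>1 ^ 2 * \<alpha>1
      + (L1 G1 G2 G3 + e * L1 H1 H2 H3 + L0 H0 H2 H3) = 0"
    unfolding defs by (simp add: numeral_char2 algebra_simps power2_eq_square power3_eq_cube)
  ultimately have "\<beta>0 ^ 2 + \<sigma> * \<beta>1 ^ 2 = 0 \<and> \<beta>1 ^ 2 = 0 \<or>
      \<alpha>0 + e ^ 2 * \<alpha>1 + e * (1 + e) * \<beta>1 = 0 \<and> \<alpha>1 = 0"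
    using L norm_form_mult_eq_0[OF \<sigma>, of "\<beta>0 ^ 2 + \<sigma> * \<beta>1 ^ 2" _ "\<beta>1 ^ 2" \<alpha>1] by simp
  then show "(\<beta>0 = 0 \<and> \<beta>1 = 0) \<or> (\<alpha>0 + e ^ 2 * \<alpha>1 + e * (1 + e) * \<beta>1 = 0 \<and> \<alpha>1 = 0)" by auto
qed

lemma mem_stabilizing_matrices_twisted:
  "(a, b, c, d) \<in> stabilizing_matrices (twisted_num \<sigma> e) (twisted_den \<sigma> (e :: 'a)) \<longleftrightarrow>
    a * d \<noteq> b * c \<and>
    in_span (twisted_num \<sigma> e) (twisted_den \<sigma> e)
      [:(e + 1) * \<sigma> * d ^ 3 + \<sigma> * b * d ^ 2 + e * b ^ 2 * d + b ^ 3,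
        (e + 1) * \<sigma> * c * d ^ 2 + \<sigma> * a * d ^ 2 + e * b ^ 2 * c + a * b ^ 2,
        (e + 1) * \<sigma> * c ^ 2 * d + \<sigma> * b * c ^ 2 + e * a ^ 2 * d + a ^ 2 * b,
        (e + 1) * \<sigma> * c ^ 3 + \<sigma> * a * c ^ 2 + e * a ^ 2 * c + a ^ 3:] \<and>
    in_span (twisted_num \<sigma> e) (twisted_den \<sigma> e)
      [:(e + 1 + \<sigma>) * d ^ 3 + b * d ^ 2 + b ^ 2 * d,
        (e + 1 + \<sigma>) * c * d ^ 2 + a * d ^ 2 + b ^ 2 * c,
        (e + 1 + \<sigma>) * c ^ 2 * d + b * c ^ 2 + a ^ 2 * d,
        (e + 1 + \<sigma>) * c ^ 3 + a * c ^ 2 + a ^ 2 * c:]"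
  using homogenize_cubic[OF char2, of "(e + 1) * \<sigma>" \<sigma> e 1 b a d c]
    homogenize_cubic[OF char2, of "e + 1 + \<sigma>" 1 1 0 b a d c]
  by (simp add: mem_stabilizing_matrices twisted_num_def twisted_den_def)

text \<open>For e = 0 the form numerator + w denominator is z^3. As for x^3 the stabilizing
  substitutions are z -> alpha z and z -> beta z', with a nonzero factor taken from the quadratic
  extension, which has q^2 - 1 such elements.\<close>

lemma card_stabilizing_matrices_twisted_0:
  assumes \<sigma>: "absolute_trace2 (\<sigma> :: 'a) = 1"
  shows "card (stabilizing_matrices (twisted_num \<sigma> 0) (twisted_den \<sigma> 0)) = 2 * (CARD('a) ^ 2 - 1)"
proof -
  note eq0 = add_eq_0_iff_eq[OF char2]
  let ?U = "UNIV - {(0 :: 'a, 0 :: 'a)}"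
  \<comment> \<open>\<open>?f\<close> solves alpha = 0 and \<open>?g\<close> solves beta = 0 for
    \<open>b\<close> and \<open>d\<close>. In both families the determinant is the norm of a + c w,
    up to sign, so it vanishes only at the excluded pair.\<close>
  let ?f = "\<lambda>(a, c). (a, a + \<sigma> * c, c, a)" and ?g = "\<lambda>(a, c). (a, \<sigma> * c, c, a + c)"
  have norm: "a ^ 2 + a * c + \<sigma> * c ^ 2 \<noteq> 0" if "(a, c) \<in> ?U" for a c
    using that norm_form_anisotropic[OF char2 \<sigma>, of a c] by auto
  have eq: "stabilizing_matrices (twisted_num \<sigma> 0) (twisted_den \<sigma> 0) = ?f ` ?U \<union> ?g ` ?U"
  proof (intro equalityI subsetI)
    fix x assume x: "x \<in> stabilizing_matrices (twisted_num \<sigma> 0) (twisted_den \<sigma> 0)"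
    obtain a b c d where abcd: "x = (a, b, c, d)" by (metis surj_pair)
    have "(a + b + \<sigma> * c = 0 \<and> a + d = 0) \<or> (b + \<sigma> * c = 0 \<and> a + c + d = 0)"
      using twisted_stabilizer_cases(1)[OF \<sigma> x[unfolded abcd]] by simp
    moreover have "b = (a + b + \<sigma> * c) + (a + \<sigma> * c)" "d = (a + d) + a"
      "b = (b + \<sigma> * c) + \<sigma> * c" "d = (a + c + d) + (a + c)"
      by (simp_all add: numeral_char2 algebra_simps)
    ultimately have "(b = a + \<sigma> * c \<and> d = a) \<or> (b = \<sigma> * c \<and> d = a + c)"
      by (metis add_0_left)
    then have "x = ?f (a, c) \<or> x = ?g (a, c)" using abcd by auto
    moreover have "(a, c) \<in> ?U"
    proof -
      have "a * d \<noteq> b * c" using x abcd by (simp add: mem_stabilizing_matrices)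
      then show ?thesis by auto
    qed
    ultimately show "x \<in> ?f ` ?U \<union> ?g ` ?U" by blast
  next
    fix x assume "x \<in> ?f ` ?U \<union> ?g ` ?U"
    then consider a c where "(a, c) \<in> ?U" "x = (a, a + \<sigma> * c, c, a)"
      | a c where "(a, c) \<in> ?U" "x = (a, \<sigma> * c, c, a + c)" by auto
    then show "x \<in> stabilizing_matrices (twisted_num \<sigma> 0) (twisted_den \<sigma> 0)"
    proof cases
      case 1
      have "a * a + (a + \<sigma> * c) * c \<noteq> 0"
        using norm[OF 1(1)] by (simp add: algebra_simps power2_eq_square)
      then have "a * a \<noteq> (a + \<sigma> * c) * c" by (simp only: eq0 not_False_eq_True)
      then show ?thesis unfolding 1(2) mem_stabilizing_matrices_twisted in_span_twisted
        by (simp add: numeral_char2 algebra_simps power2_eq_square power3_eq_cube)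
    next
      case 2
      have "a * (a + c) + \<sigma> * c * c \<noteq> 0"
        using norm[OF 2(1)] by (simp add: algebra_simps power2_eq_square)
      then have "a * (a + c) \<noteq> \<sigma> * c * c" by (simp only: eq0 not_False_eq_True)
      then show ?thesis unfolding 2(2) mem_stabilizing_matrices_twisted in_span_twisted
        by (simp add: numeral_char2 algebra_simps power2_eq_square power3_eq_cube)
    qed
  qed
  have card_U: "card ?U = CARD('a) ^ 2 - 1"
    by (simp add: card_Diff_singleton power2_eq_square card_prod)
  have inj: "inj_on ?f ?U" "inj_on ?g ?U" by (auto simp: inj_on_def)
  have "card (stabilizing_matrices (twisted_num \<sigma> 0) (twisted_den \<sigma> 0)) = card (?f ` ?U) + card (?g ` ?U)"
    unfolding eq by (rule card_Un_disjoint) auto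
  also have "\<dots> = 2 * (CARD('a) ^ 2 - 1)"
    by (simp only: card_image[OF inj(1)] card_image[OF inj(2)] card_U mult_2)
  finally show ?thesis .
qed

text \<open>For these \<open>e\<close> the form z^2 ((1 + e) z + e z') has a simple root different
  from its double one. Besides scalars only the exchange of z and z' survives, which is x -> x +
  1.\<close>

lemma card_stabilizing_matrices_twisted:
  assumes \<sigma>: "absolute_trace2 (\<sigma> :: 'a) = 1" and e: "e \<notin> {0, 1}"
  shows "card (stabilizing_matrices (twisted_num \<sigma> e) (twisted_den \<sigma> e)) = 2 * (CARD('a) - 1)"
proof -
  note eq0 = add_eq_0_iff_eq[OF char2]
  let ?U = "UNIV - {0 :: 'a}"
  have eq: "stabilizing_matrices (twisted_num \<sigma> e) (twisted_den \<sigma> e)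
      = (\<lambda>a. (a, 0, 0, a)) ` ?U \<union> (\<lambda>a. (a, a, 0, a)) ` ?U"
  proof (intro equalityI subsetI)
    fix x assume x: "x \<in> stabilizing_matrices (twisted_num \<sigma> e) (twisted_den \<sigma> e)"
    obtain a b c d where abcd: "x = (a, b, c, d)" by (metis surj_pair)
    have e1: "1 + e \<noteq> 0" using e by (auto simp: eq0)
    have det: "a * d \<noteq> b * c"
      using x abcd by (simp add: mem_stabilizing_matrices)
    note cases = twisted_stabilizer_cases[OF \<sigma> x[unfolded abcd]]
    have lin: "c = 0 \<and> d = a \<and> (b = 0 \<or> b = a)"
    \<comment> \<open>alpha = 0 leads to the exchange, with \<open>b = a\<close>; alpha nonzero
      leads to the scalar matrices.\<close>
    proof (cases "a + b + \<sigma> * c = 0 \<and> a + d = 0")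
      case True
      then have "a + c + d = 0 \<or> e * (1 + e) * (a + c + d) = 0" using cases(2) by auto
      then have "a + c + d = 0" using e e1 by simp
      moreover have "d = a" using True by (simp add: eq0)
      moreover have "c = a + d + (a + c + d)" by (simp add: numeral_char2 algebra_simps)
      ultimately have "c = 0" using True by simp
      with True \<open>d = a\<close> show ?thesis by (simp add: eq0)
    next
      case False
      then have *: "e * (1 + e) * (a + d) + e ^ 2 * (a + c + d) + (b + \<sigma> * c) = 0" "a + c + d = 0"
        using cases(1) by blast+
      have "a + d = 0"
      proof (cases "b + \<sigma> * c = 0")
        case True
        then show ?thesis using * e e1 by simp
      next
        case False
        then show ?thesis using cases(2) by blast
      qed
      then have "d = a" by (simp add: eq0)
      have "c = a + d + (a + c + d)" by (simp add: numeral_char2 algebra_simps)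
      then have "c = 0" using * \<open>a + d = 0\<close> by simp
      with * \<open>d = a\<close> show ?thesis by (simp add: add_self[OF char2])
    qed
    with det have "a \<noteq> 0" by auto
    with lin show "x \<in> (\<lambda>a. (a, 0, 0, a)) ` ?U \<union> (\<lambda>a. (a, a, 0, a)) ` ?U"
      by (auto simp: abcd image_iff)
  next
    fix x :: "'a \<times> 'a \<times> 'a \<times> 'a" assume "x \<in> (\<lambda>a. (a, 0, 0, a)) ` ?U \<union> (\<lambda>a. (a, a, 0, a)) ` ?U"
    then consider a where "a \<noteq> 0" "x = (a, 0, 0, a)" | a where "a \<noteq> 0" "x = (a, a, 0, a)" by auto
    then show "x \<in> stabilizing_matrices (twisted_num \<sigma> e) (twisted_den \<sigma> e)"
    proof cases
      case 1
      then show ?thesis unfolding 1(2) mem_stabilizing_matrices_twisted in_span_twisted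
        by (simp add: numeral_char2 algebra_simps power2_eq_square power3_eq_cube)
    next
      case 2
      then show ?thesis unfolding 2(2) mem_stabilizing_matrices_twisted in_span_twisted
        by (simp add: numeral_char2 algebra_simps power2_eq_square power3_eq_cube)
    qed
  qed
  have "card (stabilizing_matrices (twisted_num \<sigma> e) (twisted_den \<sigma> e))
      = card ((\<lambda>a :: 'a. (a, 0 :: 'a, 0 :: 'a, a)) ` ?U) + card ((\<lambda>a :: 'a. (a, a, 0 :: 'a, a)) ` ?U)"
    unfolding eq by (rule card_Un_disjoint) auto
  also have "\<dots> = 2 * (CARD('a) - 1)"
    by (simp add: card_scalar_matrices card_image inj_on_def card_UNIV_minus_0)
  finally show ?thesis .
qed

end

text \<open>\<open>s\<close> stands for the order of the stabilizer in \<open>PGL2\<close>, after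
  the scalar multiples have been divided out.\<close>

lemma card_cubics_equivalent_to_eq:
  fixes g h :: "'a::{field, finite} poly"
  assumes "Fract g h \<in> cubics" "degree g \<le> 3" "degree h \<le> 3" "h \<noteq> 0"
    and "real (card (stabilizing_matrices g h)) = s * (real CARD('a) - 1)" "s \<noteq> 0"
  shows "real (card (cubics_equivalent_to (Fract g h)))
    = real CARD('a) ^ 2 * (real CARD('a) ^ 2 - 1) ^ 2 / s"
proof -
  let ?q = "real CARD('a)"
  have "?q - 1 \<noteq> 0" using card_field_ge_2[where 'a='a] by simp
  moreover have "real (card (cubics_equivalent_to (Fract g h))) * (s * (?q - 1))
      = ?q ^ 2 * (?q ^ 2 - 1) ^ 2 * (?q - 1)"
    using card_cubics_equivalent_to[OF assms(1-4)] assms(5) by simp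
  then have "(real (card (cubics_equivalent_to (Fract g h))) * s) * (?q - 1)
      = ?q ^ 2 * (?q ^ 2 - 1) ^ 2 * (?q - 1)" by (simp only: mult.assoc)
  ultimately have "real (card (cubics_equivalent_to (Fract g h))) * s = ?q ^ 2 * (?q ^ 2 - 1) ^ 2"
    by (metis mult_right_cancel)
  then show ?thesis using assms(6) by (simp add: eq_divide_eq)
qed

section \<open>Separating the orbits of (iv), and the final counts\<close>

lemma cube_plus_over_X_cubic: "t \<noteq> 0 \<Longrightarrow> Fract [:t, 0, 0, 1:] [:0, 1:] \<in> cubics"
  by (rule cubicsI[of 1 _ "[:0, 0, - 1:]" _ t]) (auto simp: one_pCons)

text \<open>A common element makes the two normal forms equivalent, and the diagonal matrix relating
  them gives s d^3 = t a^3.\<close>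

lemma cube_plus_over_X_equivalent_imp_cube_ratio:
  fixes s t :: "'a::{field, finite}"
  assumes char2: "CHAR('a) = 2" and st: "s \<noteq> 0" "t \<noteq> 0"
    and R: "R \<in> cubics_equivalent_to (Fract [:s, 0, 0, 1:] [:0, 1:])"
      "R \<in> cubics_equivalent_to (Fract [:t, 0, 0, 1:] [:0, 1:])"
  shows "is_nth_power 3 (s / t)"
proof -
  let ?f = "\<lambda>t :: 'a. Fract [:t, 0, 0, 1:] [:0, 1:]"
  have cubic: "?f s \<in> cubics" "?f t \<in> cubics" using st cube_plus_over_X_cubic by auto
  have "?f s \<in> cubics_equivalent_to (?f t)"
    using mem_cubics_equivalent_to_of_common[OF cubic R] .
  then obtain A B where AB: "A \<in> carrier PGL2" "B \<in> carrier PGL2"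
      "rat_comp B (?f t) = rat_comp (?f s) A"
    using cubics_equivalent_to_iff[OF cubic(2)] by blast
  then obtain a b c d where m: "(a, b, c, d) \<in> GL2" "A = mobius (a, b, c, d)"
    by (auto simp: carrier_PGL2_eq)
  have "\<exists>B\<in>carrier PGL2. rat_comp B (?f t) = rat_comp (?f s) (mobius (a, b, c, d))"
    using AB m(2) by blast
  then have "in_span [:t, 0, 0, 1:] [:0, 1:] (homogenize 3 [:s, 0, 0, 1:] [:b, a:] [:d, c:]) \<and>
      in_span [:t, 0, 0, 1:] [:0, 1:] (homogenize 3 [:0, 1:] [:b, a:] [:d, c:])"
    using ex_PGL2_left_iff[OF cubic(1) _ _ _ cubic(2) _ _ _ m(1)] by (simp add: in_span_def)
  then have tr: "b = 0 \<and> c = 0 \<and> a \<noteq> 0 \<and> s * d ^ 3 = t * a ^ 3"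
    using cube_plus_over_X_transport[OF char2 st(2), of a d b c s] m(1) by (simp add: GL2_def)
  with m(1) have "d \<noteq> 0" by (auto simp: GL2_def)
  with tr st have "s / t = (a / d) ^ 3" by (simp add: power_divide frac_eq_eq)
  then show ?thesis by (rule is_nth_powerI)
qed

theorem theorem7p4:
  fixes \<sigma> \<theta> :: "'a::{field, finite}" and q :: nat
  assumes char2: "CHAR('a) = 2"
    and q: "q = CARD('a)"
    and \<sigma>: "absolute_trace2 \<sigma> = 1"
    and \<theta>: "is_square q \<Longrightarrow> \<not> is_nth_power 3 \<theta>"
  shows "
    (real (card (cubics :: 'a poly fract set)) = real q ^ 5 * (real q ^ 2 - 1)) \<and>
    (real (card (cubics_equivalent_to (Fract [:0, 0, 0, 1 :: 'a:] 1)))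
       = real q ^ 2 * (real q ^ 2 - 1) * (real q + 1) / 2) \<and>
    (real (card (cubics_equivalent_to (Fract [:\<sigma>, \<sigma>, 0, 1:] [:\<sigma> + 1, 1, 1:])))
       = real q ^ 2 * (real q ^ 2 - 1) * (real q - 1) / 2) \<and>
    (real (card (cubics_equivalent_to (Fract [:0, 0, 1, 1 :: 'a:] 1)))
       = real q ^ 2 * (real q ^ 2 - 1) ^ 2) \<and>
    (if is_square q then
       real (card (cubics_equivalent_to (Fract [:1, 0, 0, 1 :: 'a:] [:0, 1:])
                 \<union> cubics_equivalent_to (Fract [:\<theta>, 0, 0, 1:] [:0, 1:])
                 \<union> cubics_equivalent_to (Fract [:\<theta> ^ 2, 0, 0, 1:] [:0, 1:])))
         = real q ^ 2 * (real q ^ 2 - 1) ^ 2 \<and>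
       (\<forall>t \<in> {1, \<theta>, \<theta> ^ 2}.
          real (card (cubics_equivalent_to (Fract [:t, 0, 0, 1:] [:0, 1:])))
            = real q ^ 2 * (real q ^ 2 - 1) ^ 2 / 3)
     else
       real (card (cubics_equivalent_to (Fract [:1, 0, 0, 1 :: 'a:] [:0, 1:])))
         = real q ^ 2 * (real q ^ 2 - 1) ^ 2) \<and>
    (\<forall>c. c \<notin> {0, 1 :: 'a} \<longrightarrow>
       real (card (cubics_equivalent_to (Fract [:c, 0, 0, 1:] [:c, 1:])))
         = real q ^ 2 * (real q ^ 2 - 1) ^ 2 / 2) \<and>
    (\<forall>b. b \<notin> {0, 1 :: 'a} \<longrightarrow>
       real (card (cubics_equivalent_to
           (Fract [:(b + 1) * \<sigma>, \<sigma>, b, 1:] [:b + 1 + \<sigma>, 1, 1:])))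
         = real q ^ 2 * (real q ^ 2 - 1) ^ 2 / 2)"
proof -
  note two = numeral_char2[OF char2] and eq0 = add_eq_0_iff_eq[OF char2]
  have q2: "real q \<ge> 2" using card_field_ge_2[where 'a='a] by (simp add: q)
  have q1: "real (CARD('a) - 1) = real q - 1" "real (CARD('a) ^ 2 - 1) = real q ^ 2 - 1"
    using card_field_ge_2[where 'a='a] by (simp_all add: q of_nat_diff Suc_leI)
  have fin: "finite (cubics_equivalent_to S)" for S :: "'a poly fract"
    by (rule finite_subset[OF _ finite_rat_degree_le[of 3]]) (auto simp: cubics_equivalent_to_def cubics_def)
  have card_eq: "real (card (cubics_equivalent_to (Fract g h))) = real q ^ 2 * (real q ^ 2 - 1) ^ 2 / s"
    if "Fract g h \<in> cubics" "degree g \<le> 3" "degree h \<le> 3" "h \<noteq> 0"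
      "real (card (stabilizing_matrices g h)) = s * (real q - 1)" "s \<noteq> 0" for g h :: "'a poly" and s
    using card_cubics_equivalent_to_eq[OF that(1-4) that(5)[unfolded q] that(6)] by (simp only: q)

  have i: "real (card (cubics_equivalent_to (Fract [:0, 0, 0, 1 :: 'a:] 1)))
      = real q ^ 2 * (real q ^ 2 - 1) * (real q + 1) / 2"
  proof -
    have "Fract [:0, 0, 0, 1 :: 'a:] 1 \<in> cubics"
      by (rule cubicsI[of 0 _ 1 _ 1]) (auto simp: one_pCons)
    then have "real (card (cubics_equivalent_to (Fract [:0, 0, 0, 1 :: 'a:] 1)))
        = real q ^ 2 * (real q ^ 2 - 1) ^ 2 / (2 * (real q - 1))"
    proof (rule card_eq)
      show "real (card (stabilizing_matrices [:0, 0, 0, 1:] (1 :: 'a poly)))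
          = 2 * (real q - 1) * (real q - 1)"
        by (simp only: card_stabilizing_matrices_cube[OF char2] of_nat_mult of_nat_power
            of_nat_numeral q1 power2_eq_square mult.assoc)
    qed (use q2 in auto)
    also have "\<dots> = real q ^ 2 * (real q ^ 2 - 1) * (real q + 1) / 2"
    proof -
      have nz: "2 * (real q - 1) \<noteq> 0" "(2 :: real) \<noteq> 0" using q2 by auto
      show ?thesis unfolding frac_eq_eq[OF nz] by algebra
    qed
    finally show ?thesis .
  qed

  \<comment> \<open>At e = 1 the numerator is a multiple of the denominator, which is why the Bezout
    constant vanishes there and only there.\<close>
  have twisted_cubic: "Fract (twisted_num \<sigma> e) (twisted_den \<sigma> e) \<in> cubics" if "e \<noteq> 1" for e :: 'a
  proof (rule cubicsI)
    show "1 * twisted_num \<sigma> e + [:e + 1, 1:] * twisted_den \<sigma> e = [:(e + 1) ^ 2:]"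
      by (simp add: twisted_num_def twisted_den_def two algebra_simps power2_eq_square)
    show "(e + 1) ^ 2 \<noteq> 0" using that by (simp add: eq0)
  qed (auto simp: twisted_num_def twisted_den_def)
  have degs: "degree (twisted_num \<sigma> e) \<le> 3" "degree (twisted_den \<sigma> e) \<le> 3" "twisted_den \<sigma> e \<noteq> 0"
    for e :: 'a by (auto simp: twisted_num_def twisted_den_def)

  have ii: "real (card (cubics_equivalent_to (Fract [:\<sigma>, \<sigma>, 0, 1:] [:\<sigma> + 1, 1, 1:])))
      = real q ^ 2 * (real q ^ 2 - 1) * (real q - 1) / 2"
  proof -
    have "Fract [:\<sigma>, \<sigma>, 0, 1:] [:\<sigma> + 1, 1, 1:] = Fract (twisted_num \<sigma> 0) (twisted_den \<sigma> 0)"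
      by (simp add: twisted_num_def twisted_den_def add.commute)
    moreover have "real (card (stabilizing_matrices (twisted_num \<sigma> 0) (twisted_den \<sigma> 0)))
        = (2 * (real q + 1)) * (real q - 1)"
      unfolding card_stabilizing_matrices_twisted_0[OF char2 \<sigma>] of_nat_mult q1
      by (simp add: algebra_simps power2_eq_square)
    then have "real (card (cubics_equivalent_to (Fract (twisted_num \<sigma> 0) (twisted_den \<sigma> 0))))
        = real q ^ 2 * (real q ^ 2 - 1) ^ 2 / (2 * (real q + 1))"
      using q2 degs twisted_cubic by (intro card_eq) auto
    also have "\<dots> = real q ^ 2 * (real q ^ 2 - 1) * (real q - 1) / 2"
    proof -
      have nz: "2 * (real q + 1) \<noteq> 0" "(2 :: real) \<noteq> 0" using q2 by auto
      show ?thesis unfolding frac_eq_eq[OF nz] by algebra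
    qed
    ultimately show ?thesis by simp
  qed

  have iii: "real (card (cubics_equivalent_to (Fract [:0, 0, 1, 1 :: 'a:] 1)))
      = real q ^ 2 * (real q ^ 2 - 1) ^ 2"
  proof -
    have "Fract [:0, 0, 1, 1 :: 'a:] 1 \<in> cubics"
      by (rule cubicsI[of 0 _ 1 _ 1]) (auto simp: one_pCons)
    then have "real (card (cubics_equivalent_to (Fract [:0, 0, 1, 1 :: 'a:] 1)))
        = real q ^ 2 * (real q ^ 2 - 1) ^ 2 / 1"
    proof (rule card_eq)
      show "real (card (stabilizing_matrices [:0, 0, 1, 1:] (1 :: 'a poly))) = 1 * (real q - 1)"
        by (simp only: card_stabilizing_matrices_cube_plus_square[OF char2] q1 mult_1_left)
    qed auto
    then show ?thesis by simp
  qed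

  have iv: "real (card (cubics_equivalent_to (Fract [:t, 0, 0, 1:] [:0, 1:])))
      = real q ^ 2 * (real q ^ 2 - 1) ^ 2 / real (card {z :: 'a. z ^ 3 = 1})" if "t \<noteq> 0" for t :: 'a
  proof -
    have "(1 :: 'a) \<in> {z. z ^ 3 = 1}" by simp
    then have "card {z :: 'a. z ^ 3 = 1} \<noteq> 0" by (metis card_eq_0_iff empty_iff finite)
    show ?thesis
    proof (rule card_eq)
      show "Fract [:t, 0, 0, 1:] [:0, 1:] \<in> cubics" using that by (rule cube_plus_over_X_cubic)
      show "real (card (stabilizing_matrices [:t, 0, 0, 1:] [:0, 1:]))
          = real (card {z :: 'a. z ^ 3 = 1}) * (real q - 1)"
        by (simp only: card_stabilizing_matrices_cube_plus_over_X[OF char2 that] of_nat_mult q1 mult.commute)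
      show "real (card {z :: 'a. z ^ 3 = 1}) \<noteq> 0"
        using \<open>card {z :: 'a. z ^ 3 = 1} \<noteq> 0\<close> by simp
    qed auto
  qed

  have v: "real (card (cubics_equivalent_to (Fract [:c, 0, 0, 1:] [:c, 1:])))
      = real q ^ 2 * (real q ^ 2 - 1) ^ 2 / 2" if c: "c \<notin> {0, 1 :: 'a}" for c
  proof (rule card_eq)
    show "Fract [:c, 0, 0, 1:] [:c, 1:] \<in> cubics"
    proof (rule cubicsI)
      \<comment> \<open>The product on the left is x^3 + c^3 in characteristic two, so the sum is
        c^3 + c, which is nonzero exactly when c is neither 0 nor 1.\<close>
      show "1 * [:c, 0, 0, 1:] + [:c ^ 2, c, 1:] * [:c, 1:] = [:c * (c + 1) ^ 2:]"
        by (simp add: two algebra_simps power2_eq_square)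
      show "c * (c + 1) ^ 2 \<noteq> 0" using c by (simp add: eq0)
    qed auto
    show "real (card (stabilizing_matrices [:c, 0, 0, 1:] [:c, 1:])) = 2 * (real q - 1)"
      by (simp only: card_stabilizing_matrices_cube_plus_over_plus[OF char2 c] of_nat_mult q1 of_nat_numeral)
  qed auto

  have vi: "real (card (cubics_equivalent_to
        (Fract [:(b + 1) * \<sigma>, \<sigma>, b, 1:] [:b + 1 + \<sigma>, 1, 1:])))
      = real q ^ 2 * (real q ^ 2 - 1) ^ 2 / 2" if b: "b \<notin> {0, 1 :: 'a}" for b
  proof -
    have "real (card (stabilizing_matrices (twisted_num \<sigma> b) (twisted_den \<sigma> b))) = 2 * (real q - 1)"
      by (simp only: card_stabilizing_matrices_twisted[OF char2 \<sigma> b] of_nat_mult q1 of_nat_numeral)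
    then have "real (card (cubics_equivalent_to (Fract (twisted_num \<sigma> b) (twisted_den \<sigma> b))))
        = real q ^ 2 * (real q ^ 2 - 1) ^ 2 / 2"
      using b degs twisted_cubic by (intro card_eq) auto
    then show ?thesis by (simp only: twisted_num_def twisted_den_def)
  qed

  have iv': "if is_square q then
       real (card (cubics_equivalent_to (Fract [:1, 0, 0, 1 :: 'a:] [:0, 1:])
                 \<union> cubics_equivalent_to (Fract [:\<theta>, 0, 0, 1:] [:0, 1:])
                 \<union> cubics_equivalent_to (Fract [:\<theta> ^ 2, 0, 0, 1:] [:0, 1:])))
         = real q ^ 2 * (real q ^ 2 - 1) ^ 2 \<and>
       (\<forall>t \<in> {1, \<theta>, \<theta> ^ 2}.
          real (card (cubics_equivalent_to (Fract [:t, 0, 0, 1:] [:0, 1:])))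
            = real q ^ 2 * (real q ^ 2 - 1) ^ 2 / 3)
     else
       real (card (cubics_equivalent_to (Fract [:1, 0, 0, 1 :: 'a:] [:0, 1:])))
         = real q ^ 2 * (real q ^ 2 - 1) ^ 2"
  proof (cases "is_square q")
    case False
    then have "{z :: 'a. z ^ 3 = 1} = {1}"
      using cube_root_of_unity_eq_1[OF char2] by (auto simp: q)
    then show ?thesis using False iv[of 1] by simp
  next
    case True
    then have \<theta>: "\<not> is_nth_power 3 \<theta>" by (rule \<theta>)
    then have \<theta>0: "\<theta> \<noteq> 0" by auto
    let ?E = "\<lambda>t :: 'a. cubics_equivalent_to (Fract [:t, 0, 0, 1:] [:0, 1:])"
    have each: "real (card (?E t)) = real q ^ 2 * (real q ^ 2 - 1) ^ 2 / 3" if "t \<in> {1, \<theta>, \<theta> ^ 2}" for t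
    proof -
      have "t \<noteq> 0" using that \<theta>0 by auto
      then show ?thesis using iv[of t] card_cube_roots_of_unity[OF \<theta>] by simp
    qed
    have not_cube: "\<not> is_nth_power 3 (\<theta> ^ 2)"
    proof
      assume "is_nth_power 3 (\<theta> ^ 2)"
      then obtain y where y: "\<theta> ^ 2 = y ^ 3" by (auto elim: is_nth_powerE)
      have "\<theta> = \<theta> ^ 3 / \<theta> ^ 2" using \<theta>0 by (simp add: power3_eq_cube power2_eq_square)
      also have "\<dots> = (\<theta> / y) ^ 3" by (simp add: y power_divide)
      finally show False using \<theta> by (metis is_nth_power_nth_power)
    qed
    have disjoint: "?E s \<inter> ?E t = {}" if "s \<noteq> 0" "t \<noteq> 0" "\<not> is_nth_power 3 (s / t)" for s t
      using cube_plus_over_X_equivalent_imp_cube_ratio[OF char2 that(1,2)] that(3) by blast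
    \<comment> \<open>The ratios of the parameters are theta, theta^2 and theta; none of them is a
      cube.\<close>
    have "?E \<theta> \<inter> ?E 1 = {}" "?E (\<theta> ^ 2) \<inter> ?E 1 = {}" "?E (\<theta> ^ 2) \<inter> ?E \<theta> = {}"
      using \<theta> \<theta>0 not_cube by (intro disjoint; simp add: power2_eq_square)+
    then have "card (?E 1 \<union> ?E \<theta> \<union> ?E (\<theta> ^ 2)) = card (?E 1) + card (?E \<theta>) + card (?E (\<theta> ^ 2))"
      using fin by (subst card_Un_disjoint; (subst card_Un_disjoint)?) auto
    then have "real (card (?E 1 \<union> ?E \<theta> \<union> ?E (\<theta> ^ 2))) = real q ^ 2 * (real q ^ 2 - 1) ^ 2"
      using each[of 1] each[of \<theta>] each[of "\<theta> ^ 2"] by simp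
    then show ?thesis using True each by simp
  qed
  show ?thesis
    using card_cubics[where 'a='a] i ii iii iv' v vi unfolding q by blast
qed

end
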